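(* Let $(W,S)$ be a Coxeter system with length function $\ell$, let $B^+$ be the corresponding positive braid monoid, and let $\mathcal{C}$ be a category with an action of $B^+$ given by functors $T(w):\mathcal{C}\to\mathcal{C}$, $w\in W$ (with $T(1)=\mathrm{Id}$), and isomorphisms $c_{w,w'}:T(w)T(w')\xrightarrow{\sim}T(ww')$ for all $w,w'\in W$ with $\ell(ww')=\ell(w)+\ell(w')$. Let $c_{s,s}:T(s)T(s)\to\mathrm{Id}$, $s\in S$, be a collection of morphisms of functors satisfying the following two conditions. (1) For every $s\in S$ and every object $X$ of $\mathcal{C}$ one has $T(s)(c_{s,s,X})=c_{s,s,T(s)X}:T(s)^3X\to T(s)X$. (2) For every $w\in W$ and $s,s'\in S$ such that $sw=ws'$ and $\ell(sw)=\ell(w)+1$, the two compositions $$T(s)T(w)T(s')\longrightarrow T(w)T(s')^2\xrightarrow{\ T(w)c_{s',s'}\ }T(w)$$ and $$T(s)T(w)T(s')\longrightarrow T(s)^2T(w)\xrightarrow{\ c_{s,s}T(w)\ }T(w)$$ coincide, where the first arrow of the first composition is $(c_{w,s'}^{-1}c_{s,w})T(s')$ and the first arrow of the second composition is $T(s)(c_{s,w}^{-1}c_{w,s'})$ (here $c_{s,w}:T(s)T(w)\to T(sw)$ and $c_{w,s'}:T(w)T(s')\to T(ws')=T(sw)$). Then there is a canonical quasi-action of $W$ on $\mathcal{C}$, given by the functors $T(w)$, $w\in W$, and structure morphisms extending the given isomorphisms $c_{w,w'}$ (for $\ell(ww')=\ell(w)+\ell(w')$) and the given morphisms $c_{s,s}$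 ($s\in S$).
   Context: A quasi-action of a monoid $M$ on a category $\mathcal{C}$ is a collection of functors $T(f):\mathcal{C}\to\mathcal{C}$, $f\in M$, and morphisms of functors $c_{f,g}:T(f)\circ T(g)\to T(fg)$, $f,g\in M$, satisfying the associativity condition $c_{fg,h}\circ(c_{f,g}T(h))=c_{f,gh}\circ(T(f)c_{g,h})$ for all $f,g,h\in M$. An action is a quasi-action for which all $c_{f,g}$ are isomorphisms. $B^+$ is the monoid generated by $S$ with the braid relations of $(W,S)$; $\tau:W\to B^+$ is the canonical section with $\tau|_S=\mathrm{id}$ and $\tau(ww')=\tau(w)\tau(w')$ when $\ell(ww')=\ell(w)+\ell(w')$. By a theorem of Deligne, an action of $B^+$ on $\mathcal{C}$ is given by functors $T(w)$ (corresponding to $\tau(w)$, with $T(1)=\mathrm{Id}$) and isomorphisms $c_{w,w'}:T(w)T(w')\to T(ww')$ for pairs with $\ell(ww')=\ell(w)+\ell(w')$ ($c_{1,w}=c_{w,1}=\mathrm{id}$), satisfying the associativity condition for all triples $w,w',w''$ with $\ell(ww'w'')=\ell(w)+\ell(w')+\ell(w'')$; this is the meaning of "action given by" in the statement. *)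

theory Defs
  imports "HOL-Algebra.Multiplicative_Group"
begin

section \<open>Categories, functors and natural transformations\<close>

record ('o, 'a) category =
  Ob :: "'o set"
  Arr :: "'a set"
  Dom :: "'a \<Rightarrow> 'o"
  Cod :: "'a \<Rightarrow> 'o"
  Idn :: "'o \<Rightarrow> 'a"
  Comp :: "'a \<Rightarrow> 'a \<Rightarrow> 'a" (infixl \<open>\<cdot>\<index>\<close> 70)

definition Hom :: "('o, 'a) category \<Rightarrow> 'o \<Rightarrow> 'o \<Rightarrow> 'a set" where
  "Hom C X Y = {f \<in> Arr C. Dom C f = X \<and> Cod C f = Y}"

locale category =
  fixes C :: "('o, 'a) category" (structure)
  assumes Dom_in_Ob: "f \<in> Arr C \<Longrightarrow> Dom C f \<in> Ob C"
    and Cod_in_Ob: "f \<in> Arr C \<Longrightarrow> Cod C f \<in> Ob C"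
    and Idn_in_Hom: "X \<in> Ob C \<Longrightarrow> Idn C X \<in> Hom C X X"
    and Comp_in_Hom: "f \<in> Hom C X Y \<Longrightarrow> g \<in> Hom C Y Z \<Longrightarrow> g \<cdot> f \<in> Hom C X Z"
    and Comp_Idn: "f \<in> Hom C X Y \<Longrightarrow> f \<cdot> Idn C X = f"
    and Idn_Comp: "f \<in> Hom C X Y \<Longrightarrow> Idn C Y \<cdot> f = f"
    and Comp_assoc: "f \<in> Hom C X Y \<Longrightarrow> g \<in> Hom C Y Z \<Longrightarrow> h \<in> Hom C Z V \<Longrightarrow>
      (h \<cdot> g) \<cdot> f = h \<cdot> (g \<cdot> f)"

definition inverse_arrows :: "('o, 'a) category \<Rightarrow> 'a \<Rightarrow> 'a \<Rightarrow> bool" where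
  "inverse_arrows C f g \<longleftrightarrow>
     f \<in> Arr C \<and> g \<in> Hom C (Cod C f) (Dom C f) \<and>
     g \<cdot>\<^bsub>C\<^esub> f = Idn C (Dom C f) \<and> f \<cdot>\<^bsub>C\<^esub> g = Idn C (Cod C f)"

definition iso_arrow :: "('o, 'a) category \<Rightarrow> 'a \<Rightarrow> bool" where
  "iso_arrow C f \<longleftrightarrow> (\<exists>g. inverse_arrows C f g)"

definition inv_arrow :: "('o, 'a) category \<Rightarrow> 'a \<Rightarrow> 'a" where
  "inv_arrow C f = (THE g. inverse_arrows C f g)"

record ('o1, 'a1, 'o2, 'a2) functr =
  OMap :: "'o1 \<Rightarrow> 'o2"
  AMap :: "'a1 \<Rightarrow> 'a2"

definition is_functor ::
  "('o1, 'a1) category \<Rightarrow> ('o2, 'a2) category \<Rightarrow> ('o1, 'a1, 'o2, 'a2) functr \<Rightarrow> bool" where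
  "is_functor C D F \<longleftrightarrow>
     category C \<and> category D \<and>
     (\<forall>X\<in>Ob C. OMap F X \<in> Ob D) \<and>
     (\<forall>X\<in>Ob C. \<forall>Y\<in>Ob C. \<forall>f\<in>Hom C X Y. AMap F f \<in> Hom D (OMap F X) (OMap F Y)) \<and>
     (\<forall>X\<in>Ob C. AMap F (Idn C X) = Idn D (OMap F X)) \<and>
     (\<forall>X\<in>Ob C. \<forall>Y\<in>Ob C. \<forall>Z\<in>Ob C. \<forall>f\<in>Hom C X Y. \<forall>g\<in>Hom C Y Z.
        AMap F (g \<cdot>\<^bsub>C\<^esub> f) = AMap F g \<cdot>\<^bsub>D\<^esub> AMap F f)"

definition id_functor :: "('o, 'a, 'o, 'a) functr" where
  "id_functor = \<lparr>OMap = \<lambda>X. X, AMap = \<lambda>f. f\<rparr>"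

definition comp_functor ::
  "('o2, 'a2, 'o3, 'a3) functr \<Rightarrow> ('o1, 'a1, 'o2, 'a2) functr \<Rightarrow> ('o1, 'a1, 'o3, 'a3) functr"
  (infixl \<open>\<circ>\<^sub>F\<close> 55) where
  "F \<circ>\<^sub>F G = \<lparr>OMap = OMap F \<circ> OMap G, AMap = AMap F \<circ> AMap G\<rparr>"

text \<open>Maps are total in HOL, so functors out of \<open>C\<close> are compared on the objects and arrows
  of \<open>C\<close> only.\<close>

definition functor_eq ::
  "('o1, 'a1) category \<Rightarrow> ('o1, 'a1, 'o2, 'a2) functr \<Rightarrow> ('o1, 'a1, 'o2, 'a2) functr \<Rightarrow> bool" where
  "functor_eq C F G \<longleftrightarrow>
     (\<forall>X\<in>Ob C. OMap F X = OMap G X) \<and> (\<forall>f\<in>Arr C. AMap F f = AMap G f)"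

definition nat_trans ::
  "('o1, 'a1) category \<Rightarrow> ('o2, 'a2) category \<Rightarrow> ('o1, 'a1, 'o2, 'a2) functr \<Rightarrow>
   ('o1, 'a1, 'o2, 'a2) functr \<Rightarrow> ('o1 \<Rightarrow> 'a2) \<Rightarrow> bool" where
  "nat_trans C D F G \<eta> \<longleftrightarrow>
     is_functor C D F \<and> is_functor C D G \<and>
     (\<forall>X\<in>Ob C. \<eta> X \<in> Hom D (OMap F X) (OMap G X)) \<and>
     (\<forall>X\<in>Ob C. \<forall>Y\<in>Ob C. \<forall>f\<in>Hom C X Y. \<eta> Y \<cdot>\<^bsub>D\<^esub> AMap F f = AMap G f \<cdot>\<^bsub>D\<^esub> \<eta> X)"

definition nat_iso ::
  "('o1, 'a1) category \<Rightarrow> ('o2, 'a2) category \<Rightarrow> ('o1, 'a1, 'o2, 'a2) functr \<Rightarrow>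
   ('o1, 'a1, 'o2, 'a2) functr \<Rightarrow> ('o1 \<Rightarrow> 'a2) \<Rightarrow> bool" where
  "nat_iso C D F G \<eta> \<longleftrightarrow> nat_trans C D F G \<eta> \<and> (\<forall>X\<in>Ob C. iso_arrow D (\<eta> X))"

section \<open>Quasi-actions\<close>

definition quasi_action ::
  "('m, 'x) monoid_scheme \<Rightarrow> ('o, 'a) category \<Rightarrow> ('m \<Rightarrow> ('o, 'a, 'o, 'a) functr) \<Rightarrow>
   ('m \<Rightarrow> 'm \<Rightarrow> 'o \<Rightarrow> 'a) \<Rightarrow> bool" where
  "quasi_action M C T c \<longleftrightarrow>
     monoid M \<and> category C \<and>
     (\<forall>f\<in>carrier M. is_functor C C (T f)) \<and>
     (\<forall>f\<in>carrier M. \<forall>g\<in>carrier M. nat_trans C C (T f \<circ>\<^sub>F T g) (T (f \<otimes>\<^bsub>M\<^esub> g)) (c f g)) \<and>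
     (\<forall>f\<in>carrier M. \<forall>g\<in>carrier M. \<forall>h\<in>carrier M. \<forall>X\<in>Ob C.
        c (f \<otimes>\<^bsub>M\<^esub> g) h X \<cdot>\<^bsub>C\<^esub> c f g (OMap (T h) X) =
        c f (g \<otimes>\<^bsub>M\<^esub> h) X \<cdot>\<^bsub>C\<^esub> AMap (T f) (c g h X))"

section \<open>Group presentations and Coxeter systems\<close>

text \<open>Words in the letters \<open>s\<close> and \<open>s\<^sup>-\<^sup>1\<close> for \<open>s \<in> S\<close>; \<open>(s, True)\<close> stands for \<open>s\<close> and
  \<open>(s, False)\<close> for its formal inverse.\<close>

definition group_words :: "'s set \<Rightarrow> ('s \<times> bool) list set" where
  "group_words S = lists (S \<times> UNIV)"

primrec eval_word :: "('s, 'x) monoid_scheme \<Rightarrow> ('s \<times> bool) list \<Rightarrow> 's" where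
  "eval_word G [] = \<one>\<^bsub>G\<^esub>"
| "eval_word G (x # xs) = (if snd x then fst x else inv\<^bsub>G\<^esub> fst x) \<otimes>\<^bsub>G\<^esub> eval_word G xs"

text \<open>Two words are related iff they represent the same element of the quotient of the free
  group on \<open>S\<close> by the normal closure of the relators \<open>R\<close>.\<close>

inductive pres_eq :: "'s set \<Rightarrow> ('s \<times> bool) list set \<Rightarrow> ('s \<times> bool) list \<Rightarrow> ('s \<times> bool) list \<Rightarrow> bool"
  for S R where
  refl: "u \<in> group_words S \<Longrightarrow> pres_eq S R u u"
| sym: "pres_eq S R u v \<Longrightarrow> pres_eq S R v u"
| trans: "pres_eq S R u v \<Longrightarrow> pres_eq S R v w \<Longrightarrow> pres_eq S R u w"
| cancel: "u \<in> group_words S \<Longrightarrow> v \<in> group_words S \<Longrightarrow> s \<in> S \<Longrightarrow>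
    pres_eq S R (u @ [(s, b), (s, \<not> b)] @ v) (u @ v)"
| relator: "u \<in> group_words S \<Longrightarrow> v \<in> group_words S \<Longrightarrow> r \<in> R \<Longrightarrow>
    pres_eq S R (u @ r @ v) (u @ v)"

definition has_presentation ::
  "('s, 'x) monoid_scheme \<Rightarrow> 's set \<Rightarrow> ('s \<times> bool) list set \<Rightarrow> bool" where
  "has_presentation G S R \<longleftrightarrow>
     group G \<and> S \<subseteq> carrier G \<and> R \<subseteq> group_words S \<and>
     eval_word G ` group_words S = carrier G \<and>
     (\<forall>u\<in>group_words S. \<forall>v\<in>group_words S. eval_word G u = eval_word G v \<longleftrightarrow> pres_eq S R u v)"

text \<open>Since \<open>group.ord\<close> is \<open>0\<close> on elements of infinite order, a pair \<open>(s, t)\<close> with \<open>s t\<close> of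
  infinite order contributes the empty relator, that is, no relation.\<close>

definition coxeter_relators :: "('w, 'x) monoid_scheme \<Rightarrow> 'w set \<Rightarrow> ('w \<times> bool) list set" where
  "coxeter_relators W S =
     {concat (replicate (group.ord W (s \<otimes>\<^bsub>W\<^esub> t)) [(s, True), (t, True)]) | s t. s \<in> S \<and> t \<in> S}"

definition coxeter_system :: "('w, 'x) monoid_scheme \<Rightarrow> 'w set \<Rightarrow> bool" where
  "coxeter_system W S \<longleftrightarrow>
     has_presentation W S (coxeter_relators W S) \<and> (\<forall>s\<in>S. group.ord W s = 2)"

definition cox_length :: "('w, 'x) monoid_scheme \<Rightarrow> 'w set \<Rightarrow> 'w \<Rightarrow> nat" where
  "cox_length W S w =
     (LEAST n. \<exists>xs\<in>lists S. length xs = n \<and> foldr (\<otimes>\<^bsub>W\<^esub>) xs \<one>\<^bsub>W\<^esub> = w)"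

definition length_additive :: "('w, 'x) monoid_scheme \<Rightarrow> 'w set \<Rightarrow> 'w \<Rightarrow> 'w \<Rightarrow> bool" where
  "length_additive W S w w' \<longleftrightarrow>
     cox_length W S (w \<otimes>\<^bsub>W\<^esub> w') = cox_length W S w + cox_length W S w'"

section \<open>Actions of the positive braid monoid\<close>

text \<open>An action of the positive braid monoid of \<open>(W, S)\<close>, given in Deligne's form: functors
  \<open>T w\<close> for \<open>w \<in> W\<close>, and structure isomorphisms for length-additive pairs only, associative on
  length-additive triples.  The values of \<open>c\<close> on other pairs are irrelevant.\<close>

definition braid_action ::
  "('w, 'x) monoid_scheme \<Rightarrow> 'w set \<Rightarrow> ('o, 'a) category \<Rightarrow> ('w \<Rightarrow> ('o, 'a, 'o, 'a) functr) \<Rightarrow>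
   ('w \<Rightarrow> 'w \<Rightarrow> 'o \<Rightarrow> 'a) \<Rightarrow> bool" where
  "braid_action W S C T c \<longleftrightarrow>
     (\<forall>w\<in>carrier W. is_functor C C (T w)) \<and>
     functor_eq C (T \<one>\<^bsub>W\<^esub>) id_functor \<and>
     (\<forall>w\<in>carrier W. \<forall>w'\<in>carrier W. length_additive W S w w' \<longrightarrow>
        nat_iso C C (T w \<circ>\<^sub>F T w') (T (w \<otimes>\<^bsub>W\<^esub> w')) (c w w')) \<and>
     (\<forall>w\<in>carrier W. \<forall>X\<in>Ob C.
        c \<one>\<^bsub>W\<^esub> w X = Idn C (OMap (T w) X) \<and> c w \<one>\<^bsub>W\<^esub> X = Idn C (OMap (T w) X)) \<and>
     (\<forall>w\<in>carrier W. \<forall>w'\<in>carrier W. \<forall>w''\<in>carrier W.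
        cox_length W S (w \<otimes>\<^bsub>W\<^esub> w' \<otimes>\<^bsub>W\<^esub> w'') =
          cox_length W S w + cox_length W S w' + cox_length W S w'' \<longrightarrow>
        (\<forall>X\<in>Ob C.
           c (w \<otimes>\<^bsub>W\<^esub> w') w'' X \<cdot>\<^bsub>C\<^esub> c w w' (OMap (T w'') X) =
           c w (w' \<otimes>\<^bsub>W\<^esub> w'') X \<cdot>\<^bsub>C\<^esub> AMap (T w) (c w' w'' X)))"

definition extends_braid_action ::
  "('w, 'x) monoid_scheme \<Rightarrow> 'w set \<Rightarrow> ('o, 'a) category \<Rightarrow> ('w \<Rightarrow> 'w \<Rightarrow> 'o \<Rightarrow> 'a) \<Rightarrow>
   ('w \<Rightarrow> 'o \<Rightarrow> 'a) \<Rightarrow> ('w \<Rightarrow> 'w \<Rightarrow> 'o \<Rightarrow> 'a) \<Rightarrow> bool" where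
  "extends_braid_action W S C c e q \<longleftrightarrow>
     (\<forall>w\<in>carrier W. \<forall>w'\<in>carrier W. length_additive W S w w' \<longrightarrow>
        (\<forall>X\<in>Ob C. q w w' X = c w w' X)) \<and>
     (\<forall>s\<in>S. \<forall>X\<in>Ob C. q s s X = e s X)"

end

theory Submission
  imports Defs
begin

text \<open>Only multiplication by a simple reflection has to be invented.  Given \<open>s \<in> S\<close> and
  \<open>w \<in> W\<close>, there is a natural map \<open>T(s) T(w) \<rightarrow> T(s w)\<close>: if \<open>s w\<close> is longer than \<open>w\<close> it is the
  structure isomorphism of the action, and if \<open>w = s u\<close> with \<open>u\<close> shorter, it splits off \<open>T(s)\<close>
  from \<open>T(w)\<close> and contracts \<open>T(s) T(s)\<close> by \<open>e\<close>.  Right multiplication \<open>T(w) T(s) \<rightarrow> T(w s)\<close> is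
  defined in the mirror-image way.

  The key point is that left and right multiplication commute on \<open>T(s) T(w) T(s')\<close>
  (\<open>lmul_rmul\<close>).  When the lengths of \<open>w\<close>, \<open>s w\<close>, \<open>w s'\<close>, \<open>s w s'\<close> are generic this is
  associativity of the action together with naturality, since the contractions happen in disjoint
  places.  The remaining possibility is that both one-sided products are on the same side of \<open>w\<close>
  while \<open>s w s'\<close> has the length of \<open>w\<close> again; the exchange property then forces \<open>s w = w s'\<close>
  (\<open>folding\<close>).  If \<open>s w\<close> is longer than \<open>w\<close>, commutation is precisely the hypothesis
  comparing \<open>T(w) e(s')\<close> with \<open>e(s) T(w)\<close> (\<open>e_conj\<close>); if it is shorter, it follows from \<open>e_conj\<close> for
  \<open>s w\<close> and from \<open>lmul_lmul\<close>, which says that multiplying by \<open>s\<close> twice is the contraction and which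
  rests on \<open>T(s) e(s) = e(s) T(s)\<close> (\<open>e_shift\<close>).

  Now fix \<open>w\<close> and consider families of natural maps \<open>T(w) T(v) \<rightarrow> T(w v)\<close>, indexed by \<open>v\<close>, which
  are the identity at \<open>v = 1\<close> and commute with lengthening \<open>v\<close> on the right.  Such a family is
  unique, by induction on \<open>v\<close>, because the structure maps \<open>T(v) T(s) \<rightarrow> T(v s)\<close> involved are
  invertible.  It exists by induction on \<open>w\<close>: lengthening \<open>w\<close> to \<open>s w\<close>, one composes with left
  multiplication by \<open>s\<close>, and \<open>lmul_rmul\<close> says that the result is again compatible.  Uniqueness
  makes the result independent of the chosen descent \<open>s\<close>, so different reduced expressions never
  have to be compared.  Hence these families, which form the quasi-action, are compatible with
  left multiplication by every simple reflection (\<open>quasi_mult_left\<close>), and associativity, the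
  agreement with the given maps, and uniqueness of the quasi-action all follow by induction on
  the leftmost element.\<close>

section \<open>Lengths in a Coxeter group\<close>

locale coxeter_group = group W for W (structure) +
  fixes S :: "'a set"
  assumes coxeter: "coxeter_system W S"
begin

abbreviation word_prod :: "'a list \<Rightarrow> 'a" where
  "word_prod xs \<equiv> foldr (\<otimes>) xs \<one>"

abbreviation len :: "'a \<Rightarrow> nat" where
  "len \<equiv> cox_length W S"

lemma S_carrier [simp]: "s \<in> S \<Longrightarrow> s \<in> carrier W"
  using coxeter by (auto simp: coxeter_system_def has_presentation_def)

lemma S_square [simp]: "s \<in> S \<Longrightarrow> s \<otimes> s = \<one>"
  using coxeter pow_ord_eq_1[of s] by (auto simp: coxeter_system_def numeral_2_eq_2)

lemma S_inv: "s \<in> S \<Longrightarrow> inv s = s"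
  by (simp add: inv_equality)

lemma S_cancel_left [simp]: "s \<in> S \<Longrightarrow> w \<in> carrier W \<Longrightarrow> s \<otimes> (s \<otimes> w) = w"
  by (simp flip: m_assoc)

lemma S_cancel_right: "s \<in> S \<Longrightarrow> w \<in> carrier W \<Longrightarrow> w \<otimes> s \<otimes> s = w"
  by (simp add: m_assoc)

lemma word_prod_closed [simp]: "xs \<in> lists S \<Longrightarrow> word_prod xs \<in> carrier W"
  by (induction xs) auto

lemma word_prod_append:
  "xs \<in> lists S \<Longrightarrow> ys \<in> lists S \<Longrightarrow> word_prod (xs @ ys) = word_prod xs \<otimes> word_prod ys"
  by (induction xs) (auto simp: m_assoc)

lemma word_prod_rev: "xs \<in> lists S \<Longrightarrow> word_prod (rev xs) = inv (word_prod xs)"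
proof (induction xs)
  case (Cons s xs)
  then have "rev xs \<in> lists S" "[s] \<in> lists S" by auto
  then have "word_prod (rev (s # xs)) = word_prod (rev xs) \<otimes> word_prod [s]"
    by (simp only: rev.simps word_prod_append)
  then show ?case using Cons by (simp add: inv_mult_group S_inv)
qed simp

text \<open>For \<open>xs = [s\<^sub>1, \<dots>, s\<^sub>k]\<close> this is the number of indices \<open>i\<close> for which \<open>t\<close> is the reflection
  \<open>s\<^sub>1 \<cdots> s\<^sub>i \<cdots> s\<^sub>1\<close>, the one that deletes the \<open>i\<close>-th letter when multiplied from the left.  Its
  parity is an invariant of the group element, which is the source of the exchange property.\<close>
primrec refl_count :: "'a list \<Rightarrow> 'a \<Rightarrow> nat" where
  "refl_count [] t = 0"
| "refl_count (s # xs) t = of_bool (t = s) + refl_count xs (s \<otimes> t \<otimes> s)"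

lemma refl_count_append:
  assumes "xs \<in> lists S" "ys \<in> lists S" "t \<in> carrier W"
  shows "refl_count (xs @ ys) t =
    refl_count xs t + refl_count ys (inv (word_prod xs) \<otimes> t \<otimes> word_prod xs)"
  using assms
proof (induction xs arbitrary: t)
  case (Cons s xs)
  then show ?case by (auto simp: inv_mult_group S_inv m_assoc)
qed auto

text \<open>The reflections of an alternating word in \<open>s\<close> and \<open>t\<close> are those of a dihedral
  group: the \<open>i\<close>-th one, counted from \<open>0\<close>, is \<open>(s t)\<^sup>i s\<close>.\<close>
lemma refl_count_alternating:
  assumes "s \<in> S" "t \<in> S" "x \<in> carrier W"
  shows "refl_count (concat (replicate k [s, t])) x =
    (\<Sum>i<2 * k. of_bool (x = (s \<otimes> t) [^] i \<otimes> s))"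
  using assms(3)
proof (induction k arbitrary: x)
  case (Suc k)
  let ?z = "s \<otimes> t"
  have z: "?z \<in> carrier W" using assms by simp
  have shift: "t \<otimes> (s \<otimes> x \<otimes> s) \<otimes> t = ?z [^] i \<otimes> s \<longleftrightarrow> x = ?z [^] Suc (Suc i) \<otimes> s" for i :: nat
  proof -
    have p: "?z [^] i \<in> carrier W" using z by simp
    have r: "?z [^] Suc (Suc i) \<otimes> s = ?z \<otimes> (?z [^] i \<otimes> s) \<otimes> (t \<otimes> s)"
    proof -
      have "?z [^] Suc (Suc i) = ?z \<otimes> (?z [^] i \<otimes> ?z)"
        using z nat_pow_Suc2[of ?z "Suc i"] by simp
      then show ?thesis using p assms by (simp add: m_assoc)
    qed
    have "t \<otimes> (s \<otimes> x \<otimes> s) \<otimes> t = y \<longleftrightarrow> x = ?z \<otimes> y \<otimes> (t \<otimes> s)" if "y \<in> carrier W" for y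
      using that assms Suc.prems by (auto simp: m_assoc)
    from this[of "?z [^] i \<otimes> s"] r p assms show ?thesis by simp
  qed
  have one: "s \<otimes> x \<otimes> s = t \<longleftrightarrow> x = ?z \<otimes> s"
    using assms Suc.prems by (auto simp: m_assoc)
  have "refl_count (concat (replicate (Suc k) [s, t])) x =
      of_bool (x = s) + (of_bool (x = ?z \<otimes> s) +
        (\<Sum>i<2 * k. of_bool (x = ?z [^] Suc (Suc i) \<otimes> s)))"
    using Suc.IH[of "t \<otimes> (s \<otimes> x \<otimes> s) \<otimes> t"] assms Suc.prems shift one by simp
  also have "\<dots> = (\<Sum>i<Suc (Suc (2 * k)). of_bool (x = ?z [^] i \<otimes> s))"
    using assms z by (simp only: sum.lessThan_Suc_shift) simp
  finally show ?case by simp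
qed simp

text \<open>With \<open>m\<close> the order of \<open>a b\<close>, the reflections \<open>(a b)\<^sup>i a\<close> of the relator have period \<open>m\<close>
  in \<open>i\<close>, and \<open>i\<close> runs through two periods; so each reflection occurs an even number of times.\<close>
lemma relator_word:
  assumes "r \<in> coxeter_relators W S"
  shows "map fst r \<in> lists S" "word_prod (map fst r) = \<one>"
    "t \<in> carrier W \<Longrightarrow> even (refl_count (map fst r) t)"
proof -
  obtain a b where ab: "a \<in> S" "b \<in> S"
    and r: "r = concat (replicate (ord (a \<otimes> b)) [(a, True), (b, True)])"
    using assms by (auto simp: coxeter_relators_def)
  let ?z = "a \<otimes> b" and ?m = "ord (a \<otimes> b)"
  have z: "?z \<in> carrier W" using ab by simp
  have mf: "map fst r = concat (replicate ?m [a, b])"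
    by (simp add: r map_concat)
  show "map fst r \<in> lists S" using ab by (auto simp: mf split: if_splits)
  have pw: "word_prod (concat (replicate k [a, b])) = ?z [^] k" for k :: nat
  proof (induction k)
    case (Suc k)
    have "word_prod (concat (replicate (Suc k) [a, b])) = ?z \<otimes> ?z [^] k"
      using Suc ab z by (simp add: m_assoc)
    then show ?case using z nat_pow_Suc2[of ?z k] by simp
  qed simp
  show "word_prod (map fst r) = \<one>"
    using z by (simp only: mf pw pow_ord_eq_1)
  assume t: "t \<in> carrier W"
  let ?f = "\<lambda>i. of_bool (t = ?z [^] i \<otimes> a) :: nat"
  have period: "?f (?m + i) = ?f i" for i
    using z ab by (simp add: nat_pow_mult[symmetric] pow_ord_eq_1)
  have "(\<Sum>i<?m + k. g i) = (\<Sum>i<?m. g i) + (\<Sum>i<k. g (?m + i))" for g :: "nat \<Rightarrow> nat" and k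
    by (induction k) auto
  from this[of ?f ?m] have "(\<Sum>i<2 * ?m. ?f i) = (\<Sum>i<?m. ?f i) + (\<Sum>i<?m. ?f (?m + i))"
    by (simp only: mult_2)
  also have "\<dots> = 2 * (\<Sum>i<?m. ?f i)" by (simp only: period mult_2)
  finally show "even (refl_count (map fst r) t)"
    using ab t by (simp only: mf refl_count_alternating dvd_triv_left)
qed

text \<open>A word that evaluates to the identity does not change the conjugation applied to \<open>t\<close> for
  the letters after it.\<close>
lemma refl_count_insert:
  assumes "xs \<in> lists S" "ys \<in> lists S" "zs \<in> lists S" "t \<in> carrier W"
    and "word_prod ys = \<one>" "\<And>t. t \<in> carrier W \<Longrightarrow> even (refl_count ys t)"
  shows "odd (refl_count (xs @ ys @ zs) t) \<longleftrightarrow> odd (refl_count (xs @ zs) t)"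
  using assms by (simp add: refl_count_append)

lemma pres_eq_refl_count:
  assumes "pres_eq S (coxeter_relators W S) u v" "t \<in> carrier W"
  shows "odd (refl_count (map fst u) t) \<longleftrightarrow> odd (refl_count (map fst v) t)"
  using assms
proof (induction rule: pres_eq.induct)
  case (cancel u v s b)
  then have "refl_count (map fst (u @ [(s, b), (s, \<not> b)] @ v)) t = refl_count (map fst u @ [s, s] @ map fst v) t"
    by simp
  moreover have "odd (refl_count (map fst u @ [s, s] @ map fst v) t) \<longleftrightarrow> odd (refl_count (map fst u @ map fst v) t)"
  proof (rule refl_count_insert)
    show "even (refl_count [s, s] x)" if "x \<in> carrier W" for x
    proof -
      have "s \<otimes> x \<otimes> s = s \<longleftrightarrow> x = s"
        using that cancel by (metis S_cancel_left S_cancel_right S_carrier m_closed S_square r_one)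
      then show ?thesis by simp
    qed
  qed (use cancel in \<open>auto simp: group_words_def in_lists_conv_set\<close>)
  ultimately show ?case by simp
next
  case (relator u v r)
  have "odd (refl_count (map fst u @ map fst r @ map fst v) t) \<longleftrightarrow> odd (refl_count (map fst u @ map fst v) t)"
    by (rule refl_count_insert)
      (use relator relator_word[OF relator(3)] in \<open>auto simp: group_words_def in_lists_conv_set\<close>)
  then show ?case by simp
qed auto

lemma eval_word_positive:
  "u \<in> group_words S \<Longrightarrow> eval_word W u = word_prod (map fst u)"
  by (induction u) (auto simp: group_words_def S_inv)

text \<open>This is where the presentation enters: equality of the two products is generated by
  cancellations and relators, and neither changes a parity.\<close>
lemma refl_count_parity_unique:
  assumes "xs \<in> lists S" "ys \<in> lists S" "word_prod xs = word_prod ys" "t \<in> carrier W"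
  shows "odd (refl_count xs t) \<longleftrightarrow> odd (refl_count ys t)"
proof -
  let ?p = "map (\<lambda>s. (s, True))"
  have gw: "?p xs \<in> group_words S" "?p ys \<in> group_words S"
    using assms by (auto simp: group_words_def)
  have "eval_word W (?p xs) = eval_word W (?p ys)"
    using assms gw by (simp add: eval_word_positive o_def)
  then have "pres_eq S (coxeter_relators W S) (?p xs) (?p ys)"
    using coxeter gw by (auto simp: coxeter_system_def has_presentation_def)
  from pres_eq_refl_count[OF this \<open>t \<in> carrier W\<close>] show ?thesis by (simp add: o_def)
qed

lemma ex_word:
  assumes "w \<in> carrier W"
  shows "\<exists>xs\<in>lists S. word_prod xs = w"
proof -
  have "w \<in> eval_word W ` group_words S"
    using coxeter assms by (simp add: coxeter_system_def has_presentation_def)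
  then obtain u where u: "u \<in> group_words S" "eval_word W u = w" by auto
  show ?thesis
  proof
    show "word_prod (map fst u) = w" using u by (simp add: eval_word_positive)
    show "map fst u \<in> lists S" using u by (auto simp: group_words_def in_lists_conv_set)
  qed
qed

lemma len_le: "xs \<in> lists S \<Longrightarrow> len (word_prod xs) \<le> length xs"
  unfolding cox_length_def by (rule Least_le) auto

lemma ex_reduced_word:
  assumes "w \<in> carrier W"
  shows "\<exists>xs\<in>lists S. word_prod xs = w \<and> length xs = len w"
proof -
  have "\<exists>n. \<exists>xs\<in>lists S. length xs = n \<and> word_prod xs = w"
    using ex_word[OF assms] by auto
  from LeastI_ex[OF this] show ?thesis unfolding cox_length_def by auto
qed

lemma len_one [simp]: "len \<one> = 0"
  using len_le[of "[]"] by simp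

lemma len_inv: "w \<in> carrier W \<Longrightarrow> len (inv w) = len w"
proof -
  have le: "len (inv w) \<le> len w" if w: "w \<in> carrier W" for w
  proof -
    obtain xs where xs: "xs \<in> lists S" "word_prod xs = w" "length xs = len w"
      using ex_reduced_word[OF w] by auto
    have "rev xs \<in> lists S" using xs(1) by auto
    from len_le[OF this] word_prod_rev[OF xs(1)] xs show ?thesis by simp
  qed
  assume "w \<in> carrier W"
  then show ?thesis using le[of w] le[of "inv w"] by (simp add: le_antisym)
qed

lemma len_mult_le:
  assumes "v \<in> carrier W" "w \<in> carrier W"
  shows "len (v \<otimes> w) \<le> len v + len w"
proof -
  obtain xs where xs: "xs \<in> lists S" "word_prod xs = v" "length xs = len v"
    using ex_reduced_word[OF assms(1)] by auto
  obtain ys where ys: "ys \<in> lists S" "word_prod ys = w" "length ys = len w"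
    using ex_reduced_word[OF assms(2)] by auto
  have "len (word_prod (xs @ ys)) \<le> length (xs @ ys)"
    using xs ys by (intro len_le) auto
  then show ?thesis using xs ys by (simp only: word_prod_append length_append)
qed

lemma len_S_le: "s \<in> S \<Longrightarrow> len s \<le> 1"
  using len_le[of "[s]"] by simp

text \<open>If \<open>t\<close> occurs among the reflections of \<open>xs\<close>, multiplying by it deletes a letter.\<close>
lemma refl_count_pos_shortens:
  assumes "xs \<in> lists S" "t \<in> carrier W" "refl_count xs t > 0"
  shows "len (t \<otimes> word_prod xs) < length xs"
proof -
  have "\<exists>ys\<in>lists S. word_prod ys = t \<otimes> word_prod xs \<and> length ys < length xs"
    using assms
  proof (induction xs arbitrary: t)
    case (Cons s xs)
    then have s: "s \<in> S" "xs \<in> lists S" by auto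
    show ?case
    proof (cases "t = s")
      case True
      then show ?thesis using s by (intro bexI[of _ xs]) auto
    next
      case False
      then obtain ys where ys: "ys \<in> lists S" "word_prod ys = (s \<otimes> t \<otimes> s) \<otimes> word_prod xs"
          "length ys < length xs"
        using Cons.IH[of "s \<otimes> t \<otimes> s"] Cons.prems s by auto
      have "word_prod (s # ys) = t \<otimes> word_prod (s # xs)"
        using ys s Cons.prems by (simp add: m_assoc)
      then show ?thesis using ys s by (intro bexI[of _ "s # ys"]) auto
    qed
  qed simp
  then show ?thesis using len_le by fastforce
qed

text \<open>An odd count is positive, so \<open>s\<close> deletes a letter of a reduced word.  Conversely, passing
  from \<open>w\<close> to \<open>s w\<close> flips the parity at \<open>s\<close>, so an even count makes \<open>s w\<close> the longer one.\<close>
lemma left_descent_iff_odd: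
  assumes "xs \<in> lists S" "s \<in> S"
  shows "odd (refl_count xs s) \<longleftrightarrow> len (s \<otimes> word_prod xs) < len (word_prod xs)"
proof -
  have down: "len (s \<otimes> word_prod xs) < len (word_prod xs)"
    if xs: "xs \<in> lists S" and od: "odd (refl_count xs s)" for xs
  proof -
    obtain ys where ys: "ys \<in> lists S" "word_prod ys = word_prod xs" "length ys = len (word_prod xs)"
      using ex_reduced_word[of "word_prod xs"] xs by auto
    have "odd (refl_count ys s)"
      using refl_count_parity_unique[OF ys(1) xs ys(2), of s] od assms by simp
    then have "refl_count ys s > 0" by (rule odd_pos)
    from refl_count_pos_shortens[OF ys(1) _ this] assms ys show ?thesis by simp
  qed
  show ?thesis
  proof
    assume "odd (refl_count xs s)" then show "len (s \<otimes> word_prod xs) < len (word_prod xs)"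
      using down assms by blast
  next
    assume less: "len (s \<otimes> word_prod xs) < len (word_prod xs)"
    show "odd (refl_count xs s)"
    proof (rule ccontr)
      assume "\<not> odd (refl_count xs s)"
      then have "odd (refl_count (s # xs) s)" using assms by simp
      from down[OF _ this] assms less show False by simp
    qed
  qed
qed

lemma len_left_mult_cases:
  assumes "s \<in> S" "w \<in> carrier W"
  obtains "len (s \<otimes> w) = len w + 1" | "len w = len (s \<otimes> w) + 1"
proof -
  obtain xs where xs: "xs \<in> lists S" "word_prod xs = w" using ex_word[OF assms(2)] by auto
  have "len (s \<otimes> w) \<le> len w + 1"
    using len_mult_le[of s w] len_S_le[of s] assms by simp
  moreover have "len w \<le> len (s \<otimes> w) + 1"
    using len_mult_le[of s "s \<otimes> w"] len_S_le[of s] assms by simp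
  moreover have "len (s \<otimes> w) \<noteq> len w"
  proof
    assume eq: "len (s \<otimes> w) = len w"
    have "even (refl_count xs s)" "even (refl_count (s # xs) s)"
      using left_descent_iff_odd[OF xs(1) assms(1)] left_descent_iff_odd[of "s # xs" s] eq xs assms
      by auto
    then show False using assms(1) by simp
  qed
  ultimately show ?thesis using that by linarith
qed

lemma len_right_mult:
  assumes "s \<in> S" "w \<in> carrier W"
  shows "len (w \<otimes> s) = len (s \<otimes> inv w)"
proof -
  have "inv (w \<otimes> s) = s \<otimes> inv w" using assms by (simp add: inv_mult_group S_inv)
  then show ?thesis using assms len_inv[of "w \<otimes> s"] by simp
qed

lemma len_right_mult_cases:
  assumes "s \<in> S" "w \<in> carrier W"
  obtains "len (w \<otimes> s) = len w + 1" | "len w = len (w \<otimes> s) + 1"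
  using len_left_mult_cases[of s "inv w"] len_right_mult[OF assms] len_inv[of w] assms by auto

lemma len_S: "s \<in> S \<Longrightarrow> len s = 1"
  by (rule len_left_mult_cases[of s \<one>]) auto

text \<open>Appending \<open>s'\<close> to a word of \<open>w\<close> adds just one reflection, \<open>w s' w\<^sup>-\<^sup>1\<close>.  If the
  parity at \<open>s\<close> changes, that reflection has to be \<open>s\<close>.\<close>
lemma folding:
  assumes "s \<in> S" "s' \<in> S" "w \<in> carrier W"
    and up: "len (s \<otimes> w) = len w + 1" "len (w \<otimes> s') = len w + 1"
    and down: "len (s \<otimes> (w \<otimes> s')) \<noteq> len w + 2"
  shows "s \<otimes> w = w \<otimes> s'"
proof -
  obtain xs where xs: "xs \<in> lists S" "word_prod xs = w" using ex_word[OF assms(3)] by auto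
  have p: "word_prod (xs @ [s']) = w \<otimes> s'"
    using word_prod_append[of xs "[s']"] xs assms by simp
  have "len (s \<otimes> (w \<otimes> s')) < len (w \<otimes> s')"
    by (rule len_left_mult_cases[of s "w \<otimes> s'"]) (use assms in auto)
  then have "odd (refl_count (xs @ [s']) s)"
    using left_descent_iff_odd[of "xs @ [s']" s] xs p assms by simp
  moreover have "even (refl_count xs s)"
    using left_descent_iff_odd[of xs s] xs up assms by simp
  ultimately have "inv w \<otimes> s \<otimes> w = s'"
    using refl_count_append[of xs "[s']" s] xs assms by (auto split: if_splits)
  then show ?thesis
    using assms by (metis S_carrier inv_closed m_assoc m_closed r_inv l_one)
qed

lemma ex_left_descent:
  assumes "w \<in> carrier W" "w \<noteq> \<one>"
  obtains s u where "s \<in> S" "u \<in> carrier W" "w = s \<otimes> u" "len (s \<otimes> u) = len u + 1"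
proof -
  obtain xs where xs: "xs \<in> lists S" "word_prod xs = w" "length xs = len w"
    using ex_reduced_word[OF assms(1)] by auto
  then obtain s ys where ys: "xs = s # ys" using assms(2) by (cases xs) auto
  have s: "s \<in> S" "ys \<in> lists S" using xs ys by auto
  have "len (word_prod ys) < len (s \<otimes> word_prod ys)"
    using len_le[OF s(2)] xs ys by simp
  then have "len (s \<otimes> word_prod ys) = len (word_prod ys) + 1"
    by (rule_tac len_left_mult_cases[of s "word_prod ys"]) (use s in auto)
  then show ?thesis using that[of s "word_prod ys"] s xs ys by simp
qed

lemma ex_right_descent:
  assumes "w \<in> carrier W" "w \<noteq> \<one>"
  obtains s u where "s \<in> S" "u \<in> carrier W" "w = u \<otimes> s" "len (u \<otimes> s) = len u + 1"
proof -
  have "inv w \<noteq> \<one>" using assms by (metis inv_inv inv_one)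
  then obtain s u where u: "s \<in> S" "u \<in> carrier W" "inv w = s \<otimes> u" "len (s \<otimes> u) = len u + 1"
    using ex_left_descent[of "inv w"] assms by blast
  have "w = inv u \<otimes> s"
    using u assms by (metis inv_inv inv_mult_group S_carrier S_inv)
  moreover have "len (inv u \<otimes> s) = len (inv u) + 1"
    using u len_right_mult[of s "inv u"] len_inv[of u] by simp
  ultimately show ?thesis using that[of s "inv u"] u by simp
qed

lemma left_induct [consumes 1, case_names one step]:
  assumes "w \<in> carrier W" "P \<one>"
    and "\<And>s w. s \<in> S \<Longrightarrow> w \<in> carrier W \<Longrightarrow> len (s \<otimes> w) = len w + 1 \<Longrightarrow> P w \<Longrightarrow> P (s \<otimes> w)"
  shows "P w"
  using assms(1)
proof (induction "len w" arbitrary: w rule: less_induct)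
  case less
  show ?case
  proof (cases "w = \<one>")
    case False
    then show ?thesis
      using ex_left_descent[OF less.prems] less.hyps assms(3) by (metis less_add_one)
  qed (use assms in simp)
qed

lemma right_induct [consumes 1, case_names one step]:
  assumes "w \<in> carrier W" "P \<one>"
    and "\<And>s w. s \<in> S \<Longrightarrow> w \<in> carrier W \<Longrightarrow> len (w \<otimes> s) = len w + 1 \<Longrightarrow> P w \<Longrightarrow> P (w \<otimes> s)"
  shows "P w"
  using assms(1)
proof (induction "len w" arbitrary: w rule: less_induct)
  case less
  show ?case
  proof (cases "w = \<one>")
    case False
    then show ?thesis
      using ex_right_descent[OF less.prems] less.hyps assms(3) by (metis less_add_one)
  qed (use assms in simp)
qed

text \<open>If both letters lengthen \<open>u\<close> together, each step of either order of multiplication does.\<close>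
lemma len_split3:
  assumes "s \<in> S" "s' \<in> S" "u \<in> carrier W" "len (s \<otimes> (u \<otimes> s')) = len u + 2"
  shows "len (s \<otimes> u) = len u + 1" "len (u \<otimes> s') = len u + 1"
    "len (s \<otimes> (u \<otimes> s')) = len (u \<otimes> s') + 1" "len (s \<otimes> (u \<otimes> s')) = len (s \<otimes> u) + 1"
proof -
  have "len (s \<otimes> (u \<otimes> s')) \<le> 1 + len (u \<otimes> s')" "len (s \<otimes> u \<otimes> s') \<le> len (s \<otimes> u) + 1"
    "len (s \<otimes> u) \<le> 1 + len u" "len (u \<otimes> s') \<le> len u + 1"
    using len_mult_le[of s "u \<otimes> s'"] len_mult_le[of "s \<otimes> u" s'] len_mult_le[of s u] len_mult_le[of u s']
      assms by (simp_all add: len_S)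
  then show "len (s \<otimes> u) = len u + 1" "len (u \<otimes> s') = len u + 1"
    "len (s \<otimes> (u \<otimes> s')) = len (u \<otimes> s') + 1" "len (s \<otimes> (u \<otimes> s')) = len (s \<otimes> u) + 1"
    using assms by (simp_all add: m_assoc)
qed

end

section \<open>Arrows and functors in a category\<close>

context category
begin

lemma Hom_iff: "f \<in> Hom C X Y \<longleftrightarrow> f \<in> Arr C \<and> Dom C f = X \<and> Cod C f = Y"
  by (simp add: Hom_def)

lemma Arr_Comp [simp]:
  assumes "f \<in> Arr C" "g \<in> Arr C" "Cod C f = Dom C g"
  shows "g \<cdot> f \<in> Arr C" "Dom C (g \<cdot> f) = Dom C f" "Cod C (g \<cdot> f) = Cod C g"
  using Comp_in_Hom[of f "Dom C f" "Cod C f" g "Cod C g"] assms by (auto simp: Hom_iff)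

lemma Comp_assoc_Arr [simp]:
  assumes "f \<in> Arr C" "g \<in> Arr C" "h \<in> Arr C" "Cod C f = Dom C g" "Cod C g = Dom C h"
  shows "(h \<cdot> g) \<cdot> f = h \<cdot> (g \<cdot> f)"
  by (rule Comp_assoc[of f "Dom C f" "Cod C f" g "Cod C g" h "Cod C h"])
    (use assms in \<open>auto simp: Hom_iff\<close>)

lemma Arr_Idn [simp]:
  assumes "X \<in> Ob C"
  shows "Idn C X \<in> Arr C" "Dom C (Idn C X) = X" "Cod C (Idn C X) = X"
  using Idn_in_Hom[OF assms] by (auto simp: Hom_iff)

lemma Comp_Idn_Arr [simp]: "f \<in> Arr C \<Longrightarrow> Dom C f = X \<Longrightarrow> f \<cdot> Idn C X = f"
  using Comp_Idn[of f X "Cod C f"] by (simp add: Hom_iff)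

lemma Idn_Comp_Arr [simp]: "f \<in> Arr C \<Longrightarrow> Cod C f = X \<Longrightarrow> Idn C X \<cdot> f = f"
  using Idn_Comp[of f "Dom C f" X] by (simp add: Hom_iff)

lemma Dom_Cod_Ob [simp]: "f \<in> Arr C \<Longrightarrow> Dom C f \<in> Ob C" "f \<in> Arr C \<Longrightarrow> Cod C f \<in> Ob C"
  by (rule Dom_in_Ob Cod_in_Ob; assumption)+

text \<open>Lets an equation between composites be used in the middle of a right-nested chain.\<close>
lemma Comp_extend:
  assumes "g \<cdot> f = h" "f \<in> Arr C" "g \<in> Arr C" "Cod C f = Dom C g" "x \<in> Arr C" "Cod C x = Dom C f"
  shows "g \<cdot> (f \<cdot> x) = h \<cdot> x"
  using assms by (metis Comp_assoc_Arr)

lemma inverse_arrows_unique: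
  assumes "inverse_arrows C f g" "inverse_arrows C f h"
  shows "g = h"
proof -
  have "g \<cdot> (f \<cdot> h) = Idn C (Dom C f) \<cdot> h"
    by (rule Comp_extend) (use assms in \<open>auto simp: inverse_arrows_def Hom_iff\<close>)
  then show ?thesis using assms by (auto simp: inverse_arrows_def Hom_iff)
qed

lemma inverse_arrows_inv_arrow: "iso_arrow C f \<Longrightarrow> inverse_arrows C f (inv_arrow C f)"
  unfolding iso_arrow_def inv_arrow_def
  by (rule theI') (use inverse_arrows_unique in blast)

lemma iso_arrowD [simp]:
  assumes "iso_arrow C f"
  shows "f \<in> Arr C" "inv_arrow C f \<in> Arr C" "Dom C (inv_arrow C f) = Cod C f"
    "Cod C (inv_arrow C f) = Dom C f" "inv_arrow C f \<cdot> f = Idn C (Dom C f)"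
    "f \<cdot> inv_arrow C f = Idn C (Cod C f)"
  using inverse_arrows_inv_arrow[OF assms] by (auto simp: inverse_arrows_def Hom_iff)

lemma iso_cancel_extend [simp]:
  assumes "iso_arrow C f" "x \<in> Arr C"
  shows "Cod C x = Dom C f \<Longrightarrow> inv_arrow C f \<cdot> (f \<cdot> x) = x"
    "Cod C x = Cod C f \<Longrightarrow> f \<cdot> (inv_arrow C f \<cdot> x) = x"
  using assms Comp_extend[of "inv_arrow C f" f _ x] Comp_extend[of f "inv_arrow C f" _ x] by auto

lemma iso_Comp [simp]:
  assumes "iso_arrow C f" "iso_arrow C g" "Cod C f = Dom C g"
  shows "iso_arrow C (g \<cdot> f)"
  unfolding iso_arrow_def inverse_arrows_def
  by (rule exI[of _ "inv_arrow C f \<cdot> inv_arrow C g"]) (use assms in \<open>auto simp: Hom_iff\<close>)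

text \<open>Identities involving a contraction are proved below after composing with the isomorphism
  that splits off the letter to be contracted.\<close>
lemma iso_epi:
  assumes "h \<cdot> f = k \<cdot> f" "iso_arrow C f" "h \<in> Arr C" "k \<in> Arr C" "Dom C h = Cod C f" "Dom C k = Cod C f"
  shows "h = k"
proof -
  have "(h \<cdot> f) \<cdot> inv_arrow C f = (k \<cdot> f) \<cdot> inv_arrow C f" using assms(1) by simp
  then show ?thesis using assms(2-) by simp
qed

lemma functor_Arr:
  assumes "is_functor C C F"
  shows "X \<in> Ob C \<Longrightarrow> OMap F X \<in> Ob C"
    "f \<in> Arr C \<Longrightarrow> AMap F f \<in> Arr C"
    "f \<in> Arr C \<Longrightarrow> Dom C (AMap F f) = OMap F (Dom C f)"
    "f \<in> Arr C \<Longrightarrow> Cod C (AMap F f) = OMap F (Cod C f)"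
    "X \<in> Ob C \<Longrightarrow> AMap F (Idn C X) = Idn C (OMap F X)"
    "f \<in> Arr C \<Longrightarrow> g \<in> Arr C \<Longrightarrow> Cod C f = Dom C g \<Longrightarrow> AMap F (g \<cdot> f) = AMap F g \<cdot> AMap F f"
proof -
  have H: "f \<in> Hom C (Dom C f) (Cod C f)" if "f \<in> Arr C" for f using that by (simp add: Hom_iff)
  show "X \<in> Ob C \<Longrightarrow> OMap F X \<in> Ob C" "X \<in> Ob C \<Longrightarrow> AMap F (Idn C X) = Idn C (OMap F X)"
    using assms by (simp_all add: is_functor_def)
  have "AMap F f \<in> Hom C (OMap F (Dom C f)) (OMap F (Cod C f))" if "f \<in> Arr C"
    using assms H[OF that] that unfolding is_functor_def by fastforce
  then show "f \<in> Arr C \<Longrightarrow> AMap F f \<in> Arr C"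
    "f \<in> Arr C \<Longrightarrow> Dom C (AMap F f) = OMap F (Dom C f)"
    "f \<in> Arr C \<Longrightarrow> Cod C (AMap F f) = OMap F (Cod C f)"
    by (simp_all add: Hom_iff)
  show "AMap F (g \<cdot> f) = AMap F g \<cdot> AMap F f" if "f \<in> Arr C" "g \<in> Arr C" "Cod C f = Dom C g"
  proof -
    have "Dom C f \<in> Ob C" "Cod C f \<in> Ob C" "Cod C g \<in> Ob C"
      "f \<in> Hom C (Dom C f) (Cod C f)" "g \<in> Hom C (Cod C f) (Cod C g)"
      using that by (simp_all add: Hom_iff)
    then show ?thesis using assms unfolding is_functor_def by blast
  qed
qed

lemma functor_comp:
  assumes F: "is_functor C C F" and G: "is_functor C C G"
  shows "is_functor C C (F \<circ>\<^sub>F G)"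
  unfolding is_functor_def using assms
  by (auto simp: comp_functor_def Hom_iff functor_Arr[OF F] functor_Arr[OF G] category_axioms)

lemma nat_trans_comp_iff:
  assumes F: "is_functor C C F" "is_functor C C G" "is_functor C C H"
  shows "nat_trans C C (F \<circ>\<^sub>F G) H \<eta> \<longleftrightarrow>
    (\<forall>X\<in>Ob C. \<eta> X \<in> Arr C \<and> Dom C (\<eta> X) = OMap F (OMap G X) \<and> Cod C (\<eta> X) = OMap H X) \<and>
    (\<forall>f\<in>Arr C. \<eta> (Cod C f) \<cdot> AMap F (AMap G f) = AMap H f \<cdot> \<eta> (Dom C f))"
  using functor_comp[OF F(1,2)] F(3) unfolding nat_trans_def
  by (auto simp: comp_functor_def Hom_iff)

lemma functor_id: "is_functor C C id_functor"
  unfolding is_functor_def by (auto simp: id_functor_def Hom_iff category_axioms)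

end

section \<open>Braid actions with contractions\<close>

locale braid_contraction = coxeter_group W S + category C
  for W :: "('w, 'x) monoid_scheme" (structure) and S :: "'w set" and C :: "('o, 'a) category" +
  fixes T :: "'w \<Rightarrow> ('o, 'a, 'o, 'a) functr"
    and c :: "'w \<Rightarrow> 'w \<Rightarrow> 'o \<Rightarrow> 'a"
    and e :: "'w \<Rightarrow> 'o \<Rightarrow> 'a"
  assumes action: "braid_action W S C T c"
    and e_nat_trans: "\<forall>s\<in>S. nat_trans C C (T s \<circ>\<^sub>F T s) id_functor (e s)"
    and e_shift: "\<forall>s\<in>S. \<forall>X\<in>Ob C. AMap (T s) (e s X) = e s (OMap (T s) X)"
    and e_conj: "\<forall>w\<in>carrier W. \<forall>s\<in>S. \<forall>s'\<in>S.
      s \<otimes>\<^bsub>W\<^esub> w = w \<otimes>\<^bsub>W\<^esub> s' \<and> cox_length W S (s \<otimes>\<^bsub>W\<^esub> w) = cox_length W S w + 1 \<longrightarrow>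
      (\<forall>X\<in>Ob C.
         AMap (T w) (e s' X) \<cdot>\<^bsub>C\<^esub>
           (inv_arrow C (c w s' (OMap (T s') X)) \<cdot>\<^bsub>C\<^esub> c s w (OMap (T s') X)) =
         e s (OMap (T w) X) \<cdot>\<^bsub>C\<^esub>
           AMap (T s) (inv_arrow C (c s w X) \<cdot>\<^bsub>C\<^esub> c w s' X))"
begin

abbreviation cmp (infixr "\<bullet>" 70) where
  "g \<bullet> f \<equiv> Comp C g f"
abbreviation TO where "TO w \<equiv> OMap (T w)"
abbreviation TA where "TA w \<equiv> AMap (T w)"
abbreviation additive where "additive \<equiv> length_additive W S"

lemma T_functor: "w \<in> carrier W \<Longrightarrow> is_functor C C (T w)"
  using action by (simp add: braid_action_def)

lemmas T_simps [simp] = functor_Arr[OF T_functor]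

lemma T_one [simp]: "X \<in> Ob C \<Longrightarrow> TO \<one> X = X" "f \<in> Arr C \<Longrightarrow> TA \<one> f = f"
  using action by (simp_all add: braid_action_def functor_eq_def id_functor_def)

lemma c_iso [simp]:
  assumes "w \<in> carrier W" "v \<in> carrier W" "additive w v" "X \<in> Ob C"
  shows "iso_arrow C (c w v X)"
  using assms action by (simp add: braid_action_def nat_iso_def)

lemma c_nat_trans:
  assumes "w \<in> carrier W" "v \<in> carrier W" "additive w v"
  shows "nat_trans C C (T w \<circ>\<^sub>F T v) (T (w \<otimes> v)) (c w v)"
  using assms action by (simp add: braid_action_def nat_iso_def)

lemma c_simps [simp]:
  assumes "w \<in> carrier W" "v \<in> carrier W" "additive w v" "X \<in> Ob C"
  shows "c w v X \<in> Arr C" "Dom C (c w v X) = TO w (TO v X)" "Cod C (c w v X) = TO (w \<otimes> v) X"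
  using c_nat_trans[OF assms(1-3)] assms by (simp_all add: nat_trans_comp_iff T_functor)

lemma c_nat:
  assumes "w \<in> carrier W" "v \<in> carrier W" "additive w v" "f \<in> Arr C"
  shows "c w v (Cod C f) \<bullet> TA w (TA v f) = TA (w \<otimes> v) f \<bullet> c w v (Dom C f)"
  using c_nat_trans[OF assms(1-3)] assms by (simp add: nat_trans_comp_iff T_functor)

lemma c_one [simp]:
  assumes "w \<in> carrier W" "X \<in> Ob C"
  shows "c \<one> w X = Idn C (TO w X)" "c w \<one> X = Idn C (TO w X)"
  using action assms by (simp_all add: braid_action_def)

lemma c_assoc:
  assumes "u \<in> carrier W" "v \<in> carrier W" "w \<in> carrier W" "X \<in> Ob C"
    and "len (u \<otimes> (v \<otimes> w)) = len u + len v + len w"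
  shows "c (u \<otimes> v) w X \<bullet> c u v (TO w X) = c u (v \<otimes> w) X \<bullet> TA u (c v w X)"
  using action assms by (simp add: braid_action_def m_assoc)

lemma e_simps [simp]:
  assumes "s \<in> S" "X \<in> Ob C"
  shows "e s X \<in> Arr C" "Dom C (e s X) = TO s (TO s X)" "Cod C (e s X) = X"
  using e_nat_trans assms by (simp_all add: nat_trans_comp_iff T_functor functor_id)
     (simp add: id_functor_def)

lemma e_nat: "s \<in> S \<Longrightarrow> f \<in> Arr C \<Longrightarrow> e s (Cod C f) \<bullet> TA s (TA s f) = f \<bullet> e s (Dom C f)"
  using e_nat_trans by (simp add: nat_trans_comp_iff T_functor functor_id) (simp add: id_functor_def)

lemma T_e: "s \<in> S \<Longrightarrow> X \<in> Ob C \<Longrightarrow> TA s (e s X) = e s (TO s X)"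
  using e_shift by simp

lemma iso_TA [simp]:
  assumes "iso_arrow C f" "w \<in> carrier W"
  shows "iso_arrow C (TA w f)"
proof -
  have "TA w (inv_arrow C f) \<bullet> TA w f = Idn C (TO w (Dom C f))"
    "TA w f \<bullet> TA w (inv_arrow C f) = Idn C (TO w (Cod C f))"
    using assms by (simp_all flip: T_simps(6))
  then show ?thesis
    unfolding iso_arrow_def inverse_arrows_def
    by (intro exI[of _ "TA w (inv_arrow C f)"]) (use assms in \<open>auto simp: Hom_iff\<close>)
qed

lemma additive_left [simp]: "s \<in> S \<Longrightarrow> additive s w \<longleftrightarrow> len (s \<otimes> w) = len w + 1"
  by (simp add: length_additive_def len_S)

lemma additive_right [simp]: "s \<in> S \<Longrightarrow> additive w s \<longleftrightarrow> len (w \<otimes> s) = len w + 1"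
  by (simp add: length_additive_def len_S)

section \<open>Multiplication by a simple reflection\<close>

text \<open>In the second case \<open>w = s u\<close> with \<open>u = s w\<close>, and \<open>T(w)\<close> is split as \<open>T(s) T(u)\<close> before
  the two copies of \<open>T(s)\<close> are contracted.\<close>
definition lmul :: "'w \<Rightarrow> 'w \<Rightarrow> 'o \<Rightarrow> 'a" where
  "lmul s w X = (if len (s \<otimes> w) = len w + 1 then c s w X
     else e s (TO (s \<otimes> w) X) \<bullet> TA s (inv_arrow C (c s (s \<otimes> w) X)))"

definition rmul :: "'w \<Rightarrow> 'w \<Rightarrow> 'o \<Rightarrow> 'a" where
  "rmul w s X = (if len (w \<otimes> s) = len w + 1 then c w s X
     else TA (w \<otimes> s) (e s X) \<bullet> inv_arrow C (c (w \<otimes> s) s (TO s X)))"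

lemma lmul_up: "len (s \<otimes> w) = len w + 1 \<Longrightarrow> lmul s w X = c s w X"
  by (simp add: lmul_def)

lemma rmul_up: "len (w \<otimes> s) = len w + 1 \<Longrightarrow> rmul w s X = c w s X"
  by (simp add: rmul_def)

lemma lmul_down:
  assumes "s \<in> S" "u \<in> carrier W" "X \<in> Ob C" "len (s \<otimes> u) = len u + 1"
  shows "lmul s (s \<otimes> u) X \<bullet> TA s (c s u X) = e s (TO u X)"
proof -
  have "TA s (inv_arrow C (c s u X)) \<bullet> TA s (c s u X) = Idn C (TO s (TO s (TO u X)))"
    using assms by (simp flip: T_simps(6))
  then show ?thesis using assms by (simp add: lmul_def)
qed

lemma rmul_down:
  assumes "s \<in> S" "u \<in> carrier W" "X \<in> Ob C" "len (u \<otimes> s) = len u + 1"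
  shows "rmul (u \<otimes> s) s X \<bullet> c u s (TO s X) = TA u (e s X)"
  using assms by (simp add: rmul_def m_assoc)

lemma left_cases [consumes 2, case_names up down]:
  assumes "s \<in> S" "w \<in> carrier W"
  obtains "len (s \<otimes> w) = len w + 1"
  | u where "u \<in> carrier W" "w = s \<otimes> u" "len (s \<otimes> u) = len u + 1"
proof (rule len_left_mult_cases[OF assms])
  assume "len w = len (s \<otimes> w) + 1"
  then show ?thesis using that(2)[of "s \<otimes> w"] assms by simp
qed (rule that)

lemma right_cases [consumes 2, case_names up down]:
  assumes "s \<in> S" "w \<in> carrier W"
  obtains "len (w \<otimes> s) = len w + 1"
  | u where "u \<in> carrier W" "w = u \<otimes> s" "len (u \<otimes> s) = len u + 1"
proof (rule len_right_mult_cases[OF assms])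
  assume "len w = len (w \<otimes> s) + 1"
  then show ?thesis using that(2)[of "w \<otimes> s"] assms by (simp add: m_assoc)
qed (rule that)

lemma lmul_simps [simp]:
  assumes "s \<in> S" "w \<in> carrier W" "X \<in> Ob C"
  shows "lmul s w X \<in> Arr C" "Dom C (lmul s w X) = TO s (TO w X)" "Cod C (lmul s w X) = TO (s \<otimes> w) X"
  using assms(1,2) by (cases rule: left_cases; use assms in \<open>simp add: lmul_def\<close>)+

lemma rmul_simps [simp]:
  assumes "s \<in> S" "w \<in> carrier W" "X \<in> Ob C"
  shows "rmul w s X \<in> Arr C" "Dom C (rmul w s X) = TO w (TO s X)" "Cod C (rmul w s X) = TO (w \<otimes> s) X"
  using assms(1,2) by (cases rule: right_cases; use assms in \<open>simp add: rmul_def m_assoc\<close>)+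

lemma lmul_nat:
  assumes "s \<in> S" "w \<in> carrier W" "f \<in> Arr C"
  shows "lmul s w (Cod C f) \<bullet> TA s (TA w f) = TA (s \<otimes> w) f \<bullet> lmul s w (Dom C f)"
  using assms(1,2)
proof (cases rule: left_cases)
  case up
  then show ?thesis using c_nat[of s w f] assms by (simp add: lmul_up)
next
  case (down u)
  note [simp] = assms down
  let ?cc = "TA s (c s u (Dom C f))"
  note L = lmul_down[THEN Comp_extend]
  have "(lmul s w (Cod C f) \<bullet> TA s (TA w f)) \<bullet> ?cc = lmul s w (Cod C f) \<bullet> TA s (TA w f \<bullet> c s u (Dom C f))"
    by simp
  also have "\<dots> = lmul s w (Cod C f) \<bullet> TA s (c s u (Cod C f)) \<bullet> TA s (TA s (TA u f))"
    using c_nat[of s u f] by (simp flip: T_simps(6))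
  also have "\<dots> = TA u f \<bullet> e s (TO u (Dom C f))"
    using e_nat[of s "TA u f"] by (simp add: L)
  also have "\<dots> = (TA u f \<bullet> lmul s w (Dom C f)) \<bullet> ?cc"
    by (simp add: lmul_down)
  finally show ?thesis by (rule_tac iso_epi[of _ ?cc]) auto
qed

text \<open>Exactly one of the two multiplications shortens.  If it is the second, this is the
  definition of \<open>lmul\<close>.  If it is the first, the contraction takes place under \<open>T(s)\<close>, and
  \<open>e_shift\<close> moves it in front.\<close>
lemma lmul_lmul:
  assumes "s \<in> S" "v \<in> carrier W" "X \<in> Ob C"
  shows "lmul s (s \<otimes> v) X \<bullet> TA s (lmul s v X) = e s (TO v X)"
  using assms(1,2)
proof (cases rule: left_cases)
  case up
  then show ?thesis using assms lmul_down by (simp add: lmul_up)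
next
  case (down u)
  note [simp] = assms down
  let ?cc = "TA s (TA s (c s u X))"
  have "(lmul s (s \<otimes> v) X \<bullet> TA s (lmul s v X)) \<bullet> ?cc = c s u X \<bullet> TA s (lmul s v X \<bullet> TA s (c s u X))"
    by (simp add: lmul_up)
  also have "\<dots> = c s u X \<bullet> e s (TO s (TO u X))"
    by (simp add: lmul_down T_e)
  also have "\<dots> = e s (TO v X) \<bullet> ?cc"
    using e_nat[of s "c s u X"] by simp
  finally show ?thesis by (rule_tac iso_epi[of _ ?cc]) auto
qed

lemma c_assoc_two_sided:
  assumes "s \<in> S" "s' \<in> S" "u \<in> carrier W" "len (s \<otimes> (u \<otimes> s')) = len u + 2" "X \<in> Ob C"
  shows "c s (u \<otimes> s') X \<bullet> TA s (c u s' X) = c (s \<otimes> u) s' X \<bullet> c s u (TO s' X)"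
  using c_assoc[of s u s' X] assms by (simp add: len_S)

text \<open>The hypothesis \<open>e_conj\<close>, rewritten in terms of \<open>lmul\<close> and \<open>rmul\<close>: as \<open>s w = w s'\<close>, the second
  multiplication on either side is a contraction.\<close>
lemma lmul_rmul_folded:
  assumes "s \<in> S" "s' \<in> S" "w \<in> carrier W" "X \<in> Ob C"
    and eq: "s \<otimes> w = w \<otimes> s'" and len: "len (s \<otimes> w) = len w + 1"
  shows "rmul (s \<otimes> w) s' X \<bullet> lmul s w (TO s' X) = lmul s (w \<otimes> s') X \<bullet> TA s (rmul w s' X)"
proof -
  note [simp] = assms(1-4)
  have len': "len (w \<otimes> s') = len w + 1" using eq len by simp
  have cod: "Cod C (c s w Y) = TO (w \<otimes> s') Y" if "Y \<in> Ob C" for Y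
    using that eq len by simp
  have ws: "w \<otimes> s' \<otimes> s' = w" by (simp add: m_assoc)
  have "rmul (s \<otimes> w) s' X \<bullet> lmul s w (TO s' X) =
      TA w (e s' X) \<bullet> inv_arrow C (c w s' (TO s' X)) \<bullet> c s w (TO s' X)"
    using len len' by (simp add: lmul_def rmul_def eq ws cod)
  also have "\<dots> = e s (TO w X) \<bullet> TA s (inv_arrow C (c s w X) \<bullet> c w s' X)"
    using e_conj eq len by simp
  also have "\<dots> = lmul s (w \<otimes> s') X \<bullet> TA s (rmul w s' X)"
    using len len' by (simp add: lmul_def rmul_def flip: eq)
  finally show ?thesis .
qed

text \<open>One case for each choice of whether \<open>s\<close> and \<open>s'\<close> lengthen or shorten \<open>w\<close>.  When neither
  \<open>s w = w s'\<close> nor pure associativity decides, \<open>w\<close> is written with \<open>s\<close> or \<open>s'\<close> split off, and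
  the contraction slides past the other structure map by naturality.\<close>
lemma lmul_rmul:
  assumes "s \<in> S" "s' \<in> S" "w \<in> carrier W" "X \<in> Ob C"
  shows "rmul (s \<otimes> w) s' X \<bullet> lmul s w (TO s' X) = lmul s (w \<otimes> s') X \<bullet> TA s (rmul w s' X)"
  using assms(1,3)
proof (cases rule: left_cases)
  case sw: up
  from assms(2,3) show ?thesis
  proof (cases rule: right_cases)
    case ws: up
    show ?thesis
    proof (cases "len (s \<otimes> (w \<otimes> s')) = len w + 2")
      case True
      then show ?thesis using assms sw ws c_assoc_two_sided[of s s' w X]
        by (simp add: lmul_up rmul_up m_assoc)
    next
      case False
      then show ?thesis using lmul_rmul_folded[OF assms] folding[of s s' w] assms sw ws by simp
    qed
  next
    case (down u)
    note [simp] = assms down m_assoc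
    have l3: "len (s \<otimes> (u \<otimes> s')) = len u + 2" using sw by simp
    note [simp] = len_split3[OF assms(1,2) down(1) l3]
    let ?cc = "TA s (c u s' (TO s' X))"
    have su: "rmul (s \<otimes> (u \<otimes> s')) s' X \<bullet> c (s \<otimes> u) s' (TO s' X) = TA (s \<otimes> u) (e s' X)"
      using rmul_down[of s' "s \<otimes> u" X] by simp
    have "(rmul (s \<otimes> w) s' X \<bullet> lmul s w (TO s' X)) \<bullet> ?cc =
        rmul (s \<otimes> w) s' X \<bullet> c (s \<otimes> u) s' (TO s' X) \<bullet> c s u (TO s' (TO s' X))"
      by (simp add: lmul_up c_assoc_two_sided)
    also have "\<dots> = c s u X \<bullet> TA s (TA u (e s' X))"
      using c_nat[of s u "e s' X"] by (simp add: su[THEN Comp_extend])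
    also have "\<dots> = (lmul s (w \<otimes> s') X \<bullet> TA s (rmul w s' X)) \<bullet> ?cc"
      by (simp add: lmul_up rmul_down flip: T_simps(6))
    finally show ?thesis by (rule_tac iso_epi[of _ ?cc]) auto
  qed
next
  case sw: (down u)
  from assms(2,3) show ?thesis
  proof (cases rule: right_cases)
    case ws: up
    note [simp] = assms sw(1,3) m_assoc
    have l3: "len (s \<otimes> (u \<otimes> s')) = len u + 2" using ws sw(2) by simp
    note [simp] = len_split3[OF assms(1,2) sw(1) l3] sw(2)
    let ?cc = "TA s (c s u (TO s' X))"
    have "(rmul (s \<otimes> w) s' X \<bullet> lmul s w (TO s' X)) \<bullet> ?cc = c u s' X \<bullet> e s (TO u (TO s' X))"
      by (simp add: lmul_down rmul_up)
    also have "\<dots> = e s (TO (u \<otimes> s') X) \<bullet> TA s (TA s (c u s' X))"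
      using e_nat[of s "c u s' X"] by simp
    also have "\<dots> = lmul s (w \<otimes> s') X \<bullet> TA s (c s (u \<otimes> s') X \<bullet> TA s (c u s' X))"
      by (simp add: lmul_down[THEN Comp_extend])
    also have "\<dots> = (lmul s (w \<otimes> s') X \<bullet> TA s (rmul w s' X)) \<bullet> ?cc"
      by (simp add: rmul_up c_assoc_two_sided flip: T_simps(6))
    finally show ?thesis by (rule_tac iso_epi[of _ ?cc]) auto
  next
    case ws: (down u')
    show ?thesis
    proof (cases "s \<otimes> w = w \<otimes> s'")
      case True
      \<comment> \<open>Here \<open>w = s u = u s'\<close>.  The identity for \<open>u\<close>, where \<open>e_conj\<close> applies, is placed
        under \<open>T(s)\<close>, and \<open>lmul_lmul\<close> turns the double multiplication by \<open>s\<close> into a contraction.\<close>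
      have su: "s \<otimes> u = w" and lw: "len w = len u + 1" using sw by simp_all
      have sw': "s \<otimes> w = u" using sw assms by simp
      then have ws': "w \<otimes> s' = u" using True by simp
      then have us: "u \<otimes> s' = w" using S_cancel_right[of s' w] assms by simp
      note [simp] = assms sw(1) su lw sw' ws' us
      let ?cc = "TA s (c s u (TO s' X))"
      have down: "lmul s w Y \<bullet> TA s (c s u Y) = e s (TO u Y)" if "Y \<in> Ob C" for Y
        using lmul_down[of s u Y] that by simp
      have folded: "rmul w s' X \<bullet> c s u (TO s' X) = lmul s w X \<bullet> TA s (c u s' X)"
        using lmul_rmul_folded[of s s' u X] by (simp add: lmul_up rmul_up)
      have "(rmul (s \<otimes> w) s' X \<bullet> lmul s w (TO s' X)) \<bullet> ?cc = c u s' X \<bullet> e s (TO u (TO s' X))"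
        by (simp add: down rmul_up)
      also have "\<dots> = e s (TO w X) \<bullet> TA s (TA s (c u s' X))"
        using e_nat[of s "c u s' X"] by simp
      also have "\<dots> = c s u X \<bullet> TA s (lmul s w X \<bullet> TA s (c u s' X))"
        using lmul_lmul[of s w X, THEN Comp_extend, of "TA s (TA s (c u s' X))"]
        by (simp add: lmul_up)
      also have "\<dots> = (lmul s (w \<otimes> s') X \<bullet> TA s (rmul w s' X)) \<bullet> ?cc"
        by (simp add: lmul_up folded[symmetric])
      finally show ?thesis by (rule_tac iso_epi[of _ ?cc]) auto
    next
      case False
      \<comment> \<open>Otherwise \<open>folding\<close> for \<open>u = s w\<close> would give \<open>s w = w s'\<close>.  So \<open>w = s v s'\<close>
        is a reduced factorization and the two contractions are independent.\<close>
      have "len (u \<otimes> s') \<noteq> len u + 1"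
      proof
        assume up: "len (u \<otimes> s') = len u + 1"
        have "w \<otimes> s' = u'" using ws assms by (simp add: m_assoc)
        then have "s \<otimes> (u \<otimes> s') = u'" using sw assms by (simp add: m_assoc)
        then have "len (s \<otimes> (u \<otimes> s')) \<noteq> len u + 2" using sw ws by simp
        from folding[OF assms(1,2) sw(1,3) up this] have "w = u \<otimes> s'" using sw(2) by simp
        then have "w \<otimes> s' = u" using S_cancel_right[of s' u] sw(1) assms by simp
        moreover have "s \<otimes> w = u" using sw assms by simp
        ultimately show False using False by simp
      qed
      with assms(2) sw(1) obtain v where v: "v \<in> carrier W" "u = v \<otimes> s'" "len (v \<otimes> s') = len v + 1"
        by (cases rule: right_cases) auto
      note [simp] = assms sw(2) v m_assoc
      have l3: "len (s \<otimes> (v \<otimes> s')) = len v + 2" using sw(3) by simp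
      note [simp] = len_split3[OF assms(1,2) v(1) l3]
      let ?c1 = "TA s (TA s (c v s' (TO s' X)))"
      let ?cc = "TA s (c s u (TO s' X)) \<bullet> ?c1"
      have sv: "rmul (s \<otimes> (v \<otimes> s')) s' X \<bullet> c (s \<otimes> v) s' (TO s' X) = TA (s \<otimes> v) (e s' X)"
        using rmul_down[of s' "s \<otimes> v" X] by simp
      have "(rmul (s \<otimes> w) s' X \<bullet> lmul s w (TO s' X)) \<bullet> ?cc =
          rmul u s' X \<bullet> e s (TO u (TO s' X)) \<bullet> ?c1"
        by (simp add: lmul_down[THEN Comp_extend])
      also have "\<dots> = rmul u s' X \<bullet> c v s' (TO s' X) \<bullet> e s (TO v (TO s' (TO s' X)))"
        using e_nat[of s "c v s' (TO s' X)"] by simp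
      also have "\<dots> = TA v (e s' X) \<bullet> e s (TO v (TO s' (TO s' X)))"
        by (simp add: rmul_down[THEN Comp_extend])
      also have "\<dots> = e s (TO v X) \<bullet> TA s (TA s (TA v (e s' X)))"
        using e_nat[of s "TA v (e s' X)"] by simp
      also have "\<dots> = lmul s (s \<otimes> v) X \<bullet> TA s (c s v X \<bullet> TA s (TA v (e s' X)))"
        by (simp add: lmul_down[THEN Comp_extend])
      also have "c s v X \<bullet> TA s (TA v (e s' X)) =
          rmul w s' X \<bullet> c (s \<otimes> v) s' (TO s' X) \<bullet> c s v (TO s' (TO s' X))"
        using c_nat[of s v "e s' X"] by (simp add: sv[THEN Comp_extend])
      also have "\<dots> = rmul w s' X \<bullet> c s u (TO s' X) \<bullet> TA s (c v s' (TO s' X))"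
        by (simp add: c_assoc_two_sided)
      also have "lmul s (s \<otimes> v) X \<bullet> TA s \<dots> = (lmul s (w \<otimes> s') X \<bullet> TA s (rmul w s' X)) \<bullet> ?cc"
        by simp
      finally show ?thesis by (rule_tac iso_epi[of _ ?cc]) auto
    qed
  qed
qed

section \<open>Families compatible with right multiplication\<close>

text \<open>In a quasi-action extending the given data, the structure maps \<open>T(w) T(v) \<rightarrow> T(w v)\<close> for fixed
  \<open>w\<close> have these properties.  They determine the maps without reference to a factorization of
  \<open>w\<close>.\<close>
definition right_compatible :: "'w \<Rightarrow> ('w \<Rightarrow> 'o \<Rightarrow> 'a) \<Rightarrow> bool" where
  "right_compatible w \<phi> \<longleftrightarrow>
     (\<forall>v\<in>carrier W. nat_trans C C (T w \<circ>\<^sub>F T v) (T (w \<otimes> v)) (\<phi> v)) \<and>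
     (\<forall>X\<in>Ob C. \<phi> \<one> X = Idn C (TO w X)) \<and>
     (\<forall>v\<in>carrier W. \<forall>s\<in>S. \<forall>X\<in>Ob C. len (v \<otimes> s) = len v + 1 \<longrightarrow>
        \<phi> (v \<otimes> s) X \<bullet> TA w (c v s X) = rmul (w \<otimes> v) s X \<bullet> \<phi> v (TO s X))"

lemma right_compatible_simps:
  assumes "right_compatible w \<phi>" "w \<in> carrier W" "v \<in> carrier W" "X \<in> Ob C"
  shows "\<phi> v X \<in> Arr C" "Dom C (\<phi> v X) = TO w (TO v X)" "Cod C (\<phi> v X) = TO (w \<otimes> v) X"
  using assms by (simp_all add: right_compatible_def nat_trans_comp_iff T_functor)

lemma right_compatible_nat:
  assumes "right_compatible w \<phi>" "w \<in> carrier W" "v \<in> carrier W" "f \<in> Arr C"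
  shows "\<phi> v (Cod C f) \<bullet> TA w (TA v f) = TA (w \<otimes> v) f \<bullet> \<phi> v (Dom C f)"
  using assms by (simp add: right_compatible_def nat_trans_comp_iff T_functor)

text \<open>The map at \<open>v s\<close> is determined by the one at \<open>v\<close>, because \<open>c v s\<close> is invertible when \<open>v s\<close> is
  longer than \<open>v\<close>.\<close>
lemma right_compatible_unique:
  assumes "right_compatible w \<phi>" "right_compatible w \<psi>" "w \<in> carrier W" "v \<in> carrier W" "X \<in> Ob C"
  shows "\<phi> v X = \<psi> v X"
  using assms(4,5)
proof (induction v arbitrary: X rule: right_induct)
  case one
  then show ?case using assms(1,2) by (simp add: right_compatible_def)
next
  case (step s v)
  note [simp] = step(1-3,5) assms(3) right_compatible_simps[OF assms(1)] right_compatible_simps[OF assms(2)]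
  have "\<phi> (v \<otimes> s) X \<bullet> TA w (c v s X) = \<psi> (v \<otimes> s) X \<bullet> TA w (c v s X)"
    using assms(1,2) step by (simp add: right_compatible_def)
  then show ?case by (rule iso_epi) auto
qed

lemma right_compatible_one: "right_compatible \<one> (\<lambda>v X. Idn C (TO v X))"
  unfolding right_compatible_def
  by (auto simp: nat_trans_comp_iff T_functor rmul_up)

text \<open>The new family splits \<open>T(s w)\<close> into \<open>T(s) T(w)\<close>, applies the family of \<open>w\<close> under \<open>T(s)\<close>,
  and multiplies by \<open>s\<close> on the left.  It is compatible with right multiplication because left
  and right multiplication commute.\<close>
lemma right_compatible_step:
  assumes \<phi>: "right_compatible w \<phi>" and s: "s \<in> S" and w: "w \<in> carrier W"
    and len: "len (s \<otimes> w) = len w + 1"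
  shows "right_compatible (s \<otimes> w)
    (\<lambda>v X. lmul s (w \<otimes> v) X \<bullet> TA s (\<phi> v X) \<bullet> inv_arrow C (c s w (TO v X)))"
    (is "right_compatible _ ?\<psi>")
proof -
  note [simp] = s w len right_compatible_simps[OF \<phi>] m_assoc
  have arrows: "?\<psi> v X \<in> Arr C" "Dom C (?\<psi> v X) = TO (s \<otimes> w) (TO v X)"
      "Cod C (?\<psi> v X) = TO (s \<otimes> (w \<otimes> v)) X"
    if "v \<in> carrier W" "X \<in> Ob C" for v X
    using that by simp_all
  have nat: "?\<psi> v (Cod C f) \<bullet> TA (s \<otimes> w) (TA v f) = TA (s \<otimes> (w \<otimes> v)) f \<bullet> ?\<psi> v (Dom C f)"
    if [simp]: "v \<in> carrier W" "f \<in> Arr C" for v f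
  proof -
    let ?cc = "c s w (TO v (Dom C f))"
    have "(?\<psi> v (Cod C f) \<bullet> TA (s \<otimes> w) (TA v f)) \<bullet> ?cc =
        lmul s (w \<otimes> v) (Cod C f) \<bullet> TA s (\<phi> v (Cod C f) \<bullet> TA w (TA v f))"
      using c_nat[of s w "TA v f", symmetric] by simp
    also have "\<dots> = lmul s (w \<otimes> v) (Cod C f) \<bullet> TA s (TA (w \<otimes> v) f) \<bullet> TA s (\<phi> v (Dom C f))"
      using right_compatible_nat[OF \<phi>] by simp
    also have "\<dots> = (TA (s \<otimes> (w \<otimes> v)) f \<bullet> ?\<psi> v (Dom C f)) \<bullet> ?cc"
      by (simp add: lmul_nat[THEN Comp_extend])
    finally show ?thesis by (rule iso_epi) auto
  qed
  have comp: "?\<psi> (v \<otimes> s') X \<bullet> TA (s \<otimes> w) (c v s' X) = rmul (s \<otimes> (w \<otimes> v)) s' X \<bullet> ?\<psi> v (TO s' X)"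
    if [simp]: "v \<in> carrier W" "s' \<in> S" "X \<in> Ob C" "len (v \<otimes> s') = len v + 1" for v s' X
  proof -
    let ?cc = "c s w (TO v (TO s' X))"
    have "(?\<psi> (v \<otimes> s') X \<bullet> TA (s \<otimes> w) (c v s' X)) \<bullet> ?cc =
        lmul s (w \<otimes> (v \<otimes> s')) X \<bullet> TA s (\<phi> (v \<otimes> s') X \<bullet> TA w (c v s' X))"
      using c_nat[of s w "c v s' X", symmetric] by simp
    also have "\<dots> = lmul s (w \<otimes> (v \<otimes> s')) X \<bullet> TA s (rmul (w \<otimes> v) s' X) \<bullet> TA s (\<phi> v (TO s' X))"
      using \<phi> by (simp add: right_compatible_def)
    also have "\<dots> = (rmul (s \<otimes> (w \<otimes> v)) s' X \<bullet> ?\<psi> v (TO s' X)) \<bullet> ?cc"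
      using lmul_rmul[of s s' "w \<otimes> v" X, THEN Comp_extend, of "TA s (\<phi> v (TO s' X))"] by simp
    finally show ?thesis by (rule iso_epi) auto
  qed
  have "?\<psi> \<one> X = Idn C (TO (s \<otimes> w) X)" if "X \<in> Ob C" for X
    using \<phi> that by (simp add: right_compatible_def lmul_up)
  then show ?thesis
    unfolding right_compatible_def using arrows nat comp
    by (auto simp: nat_trans_comp_iff T_functor simp del: Comp_assoc_Arr)
qed

lemma ex_right_compatible: "w \<in> carrier W \<Longrightarrow> \<exists>\<phi>. right_compatible w \<phi>"
proof (induction w rule: left_induct)
  case one
  show ?case using right_compatible_one by blast
next
  case (step s w)
  then show ?case using right_compatible_step by blast
qed

section \<open>The quasi-action\<close>

definition quasi_mult :: "'w \<Rightarrow> 'w \<Rightarrow> 'o \<Rightarrow> 'a" where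
  "quasi_mult w = (SOME \<phi>. right_compatible w \<phi>)"

lemma right_compatible_quasi_mult: "w \<in> carrier W \<Longrightarrow> right_compatible w (quasi_mult w)"
  unfolding quasi_mult_def using someI_ex[OF ex_right_compatible] .

lemmas quasi_mult_simps [simp] = right_compatible_simps[OF right_compatible_quasi_mult]

lemma quasi_mult_one [simp]: "v \<in> carrier W \<Longrightarrow> X \<in> Ob C \<Longrightarrow> quasi_mult \<one> v X = Idn C (TO v X)"
  using right_compatible_unique[OF right_compatible_quasi_mult right_compatible_one] by simp

text \<open>By uniqueness, the family of \<open>s w\<close> is the one built from \<open>s\<close> and \<open>w\<close>, whichever descent
  of \<open>s w\<close> the letter \<open>s\<close> is.\<close>
lemma quasi_mult_left_up:
  assumes "s \<in> S" "w \<in> carrier W" "v \<in> carrier W" "X \<in> Ob C" "len (s \<otimes> w) = len w + 1"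
  shows "quasi_mult (s \<otimes> w) v X \<bullet> c s w (TO v X) = lmul s (w \<otimes> v) X \<bullet> TA s (quasi_mult w v X)"
proof -
  note [simp] = assms
  have "quasi_mult (s \<otimes> w) v X = lmul s (w \<otimes> v) X \<bullet> TA s (quasi_mult w v X) \<bullet> inv_arrow C (c s w (TO v X))"
    using right_compatible_unique[OF right_compatible_quasi_mult right_compatible_step[OF right_compatible_quasi_mult]]
    by simp
  then show ?thesis by (simp add: m_assoc)
qed

text \<open>For shortening \<open>s\<close>, with \<open>w = s u\<close>, both sides become the contraction in front of the family
  of \<open>u\<close>: on the left by definition, on the right by \<open>quasi_mult_left_up\<close> for \<open>u\<close> followed by
  \<open>lmul_lmul\<close>.\<close>
lemma quasi_mult_left:
  assumes "s \<in> S" "w \<in> carrier W" "v \<in> carrier W" "X \<in> Ob C"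
  shows "quasi_mult (s \<otimes> w) v X \<bullet> lmul s w (TO v X) = lmul s (w \<otimes> v) X \<bullet> TA s (quasi_mult w v X)"
  using assms(1,2)
proof (cases rule: left_cases)
  case up
  then show ?thesis using assms quasi_mult_left_up by (simp add: lmul_up)
next
  case (down u)
  note [simp] = assms down m_assoc
  let ?cc = "TA s (c s u (TO v X))"
  have "(quasi_mult (s \<otimes> w) v X \<bullet> lmul s w (TO v X)) \<bullet> ?cc = quasi_mult u v X \<bullet> e s (TO u (TO v X))"
    by (simp add: lmul_down)
  also have "\<dots> = e s (TO (u \<otimes> v) X) \<bullet> TA s (TA s (quasi_mult u v X))"
    using e_nat[of s "quasi_mult u v X"] by simp
  also have "\<dots> = lmul s (s \<otimes> (u \<otimes> v)) X \<bullet> TA s (lmul s (u \<otimes> v) X \<bullet> TA s (quasi_mult u v X))"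
    using lmul_lmul[of s "u \<otimes> v" X, THEN Comp_extend, of "TA s (TA s (quasi_mult u v X))"] by simp
  also have "\<dots> = lmul s (s \<otimes> (u \<otimes> v)) X \<bullet> TA s (quasi_mult w v X \<bullet> c s u (TO v X))"
    using quasi_mult_left_up[of s u v X] by simp
  also have "\<dots> = (lmul s (w \<otimes> v) X \<bullet> TA s (quasi_mult w v X)) \<bullet> ?cc"
    by simp
  finally show ?thesis by (rule_tac iso_epi[of _ ?cc]) auto
qed

lemma quasi_mult_S:
  assumes "s \<in> S" "w \<in> carrier W" "X \<in> Ob C"
  shows "quasi_mult s w X = lmul s w X"
  using quasi_mult_left[of s \<one> w X] assms by (simp add: lmul_up len_S)

lemma quasi_mult_assoc:
  assumes "f \<in> carrier W" "g \<in> carrier W" "h \<in> carrier W" "X \<in> Ob C"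
  shows "quasi_mult (f \<otimes> g) h X \<bullet> quasi_mult f g (TO h X) = quasi_mult f (g \<otimes> h) X \<bullet> TA f (quasi_mult g h X)"
  using assms(1)
proof (induction f rule: left_induct)
  case one
  then show ?case using assms by simp
next
  case (step s f)
  note [simp] = step(1-3) assms(2-4) m_assoc
  let ?cc = "c s f (TO g (TO h X))"
  have "(quasi_mult (s \<otimes> f \<otimes> g) h X \<bullet> quasi_mult (s \<otimes> f) g (TO h X)) \<bullet> ?cc =
      quasi_mult (s \<otimes> (f \<otimes> g)) h X \<bullet> lmul s (f \<otimes> g) (TO h X) \<bullet> TA s (quasi_mult f g (TO h X))"
    by (simp add: quasi_mult_left_up)
  also have "\<dots> = lmul s (f \<otimes> (g \<otimes> h)) X \<bullet> TA s (quasi_mult (f \<otimes> g) h X \<bullet> quasi_mult f g (TO h X))"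
    by (simp add: quasi_mult_left[THEN Comp_extend])
  also have "\<dots> = lmul s (f \<otimes> (g \<otimes> h)) X \<bullet> TA s (quasi_mult f (g \<otimes> h) X) \<bullet> TA s (TA f (quasi_mult g h X))"
    by (simp add: step.IH)
  also have "\<dots> = quasi_mult (s \<otimes> f) (g \<otimes> h) X \<bullet> c s f (TO (g \<otimes> h) X) \<bullet> TA s (TA f (quasi_mult g h X))"
    by (simp add: quasi_mult_left_up[THEN Comp_extend])
  also have "\<dots> = (quasi_mult (s \<otimes> f) (g \<otimes> h) X \<bullet> TA (s \<otimes> f) (quasi_mult g h X)) \<bullet> ?cc"
    using c_nat[of s f "quasi_mult g h X"] by simp
  finally show ?case by (rule iso_epi) auto
qed

lemma additive_step:
  assumes "s \<in> S" "w \<in> carrier W" "v \<in> carrier W" "len (s \<otimes> w) = len w + 1" "additive (s \<otimes> w) v"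
  shows "additive w v" "len (s \<otimes> (w \<otimes> v)) = len (w \<otimes> v) + 1"
proof -
  have "len (s \<otimes> (w \<otimes> v)) = len w + 1 + len v" "len (w \<otimes> v) \<le> len w + len v"
    "len (s \<otimes> (w \<otimes> v)) \<le> len (w \<otimes> v) + 1"
    using assms len_mult_le[of w v] len_mult_le[of s "w \<otimes> v"]
    by (simp_all add: length_additive_def m_assoc len_S)
  then show "additive w v" "len (s \<otimes> (w \<otimes> v)) = len (w \<otimes> v) + 1"
    by (simp_all add: length_additive_def)
qed

lemma quasi_mult_additive:
  assumes "w \<in> carrier W" "v \<in> carrier W" "additive w v" "X \<in> Ob C"
  shows "quasi_mult w v X = c w v X"
  using assms(1,3)
proof (induction w rule: left_induct)
  case one
  then show ?case using assms by simp
next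
  case (step s w)
  note add = additive_step[OF step(1,2) assms(2) step(3,5)]
  note [simp] = step(1-3,5) assms(2,4) add
  let ?cc = "c s w (TO v X)"
  have "quasi_mult (s \<otimes> w) v X \<bullet> ?cc = c s (w \<otimes> v) X \<bullet> TA s (c w v X)"
    by (simp add: quasi_mult_left_up step.IH lmul_up)
  also have "\<dots> = c (s \<otimes> w) v X \<bullet> ?cc"
    using c_assoc[of s w v X] step(5) add by (simp add: length_additive_def len_S)
  finally show ?case by (rule iso_epi) auto
qed

lemma quasi_mult_SS: "s \<in> S \<Longrightarrow> X \<in> Ob C \<Longrightarrow> quasi_mult s s X = e s X"
  using lmul_down[of s \<one> X] by (simp add: quasi_mult_S len_S)

theorem quasi_action_quasi_mult: "quasi_action W C T quasi_mult"
  unfolding quasi_action_def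
  using right_compatible_quasi_mult quasi_mult_assoc
  by (auto simp: is_monoid category_axioms T_functor right_compatible_def)

theorem extends_quasi_mult: "extends_braid_action W S C c e quasi_mult"
  by (simp add: extends_braid_action_def quasi_mult_additive quasi_mult_SS)

text \<open>Associativity for \<open>s, s, u\<close> determines any extension on pairs \<open>(s, s u)\<close>, so it agrees with
  \<open>lmul\<close> on all pairs \<open>(s, v)\<close>.  Associativity for \<open>s, w, v\<close> then gives it the recursion of
  \<open>quasi_mult_left_up\<close>.\<close>
theorem quasi_mult_unique:
  assumes qa: "quasi_action W C T q" and ext: "extends_braid_action W S C c e q"
    and "w \<in> carrier W" "v \<in> carrier W" "X \<in> Ob C"
  shows "q w v X = quasi_mult w v X"
proof -
  have nat: "nat_trans C C (T u \<circ>\<^sub>F T v) (T (u \<otimes> v)) (q u v)" if "u \<in> carrier W" "v \<in> carrier W" for u v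
    using qa that by (simp add: quasi_action_def)
  have q_simps [simp]: "q u v Y \<in> Arr C" "Dom C (q u v Y) = TO u (TO v Y)" "Cod C (q u v Y) = TO (u \<otimes> v) Y"
    if "u \<in> carrier W" "v \<in> carrier W" "Y \<in> Ob C" for u v Y
    using nat[OF that(1,2)] that by (simp_all add: nat_trans_comp_iff T_functor)
  have q_assoc: "q (f \<otimes> g) h Y \<bullet> q f g (TO h Y) = q f (g \<otimes> h) Y \<bullet> TA f (q g h Y)"
    if "f \<in> carrier W" "g \<in> carrier W" "h \<in> carrier W" "Y \<in> Ob C" for f g h Y
    using qa that by (simp add: quasi_action_def)
  have q_c: "q u v Y = c u v Y" if "u \<in> carrier W" "v \<in> carrier W" "additive u v" "Y \<in> Ob C" for u v Y
    using ext that by (simp add: extends_braid_action_def)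
  have q_e: "q s s Y = e s Y" if "s \<in> S" "Y \<in> Ob C" for s Y
    using ext that by (simp add: extends_braid_action_def)
  have q_one: "q \<one> v Y = Idn C (TO v Y)" if "v \<in> carrier W" "Y \<in> Ob C" for v Y
    using that q_c[of \<one> v Y] by (simp add: length_additive_def)
  have q_S: "q s v Y = lmul s v Y" if s: "s \<in> S" and v: "v \<in> carrier W" and [simp]: "Y \<in> Ob C" for s v Y
    using s v
  proof (cases rule: left_cases)
    case up
    then show ?thesis using s v q_c by (simp add: lmul_up)
  next
    case (down u)
    note [simp] = s down
    have "q s v Y \<bullet> TA s (c s u Y) = lmul s v Y \<bullet> TA s (c s u Y)"
      using q_assoc[of s s u Y] by (simp add: lmul_down q_c q_e q_one)
    then show ?thesis by (rule iso_epi) auto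
  qed
  from assms(3) show ?thesis
  proof (induction w rule: left_induct)
    case one
    then show ?case using assms q_one by simp
  next
    case (step s w)
    note [simp] = step(1-3) assms(4,5)
    have "q (s \<otimes> w) v X \<bullet> c s w (TO v X) = quasi_mult (s \<otimes> w) v X \<bullet> c s w (TO v X)"
      using q_assoc[of s w v X] step.IH by (simp add: q_c q_S quasi_mult_left_up)
    then show ?case by (rule iso_epi) auto
  qed
qed

end

theorem theorem3p2p2:
  fixes W :: "('w, 'x) monoid_scheme" and S :: "'w set"
    and C :: "('o, 'a) category"
    and T :: "'w \<Rightarrow> ('o, 'a, 'o, 'a) functr"
    and c :: "'w \<Rightarrow> 'w \<Rightarrow> 'o \<Rightarrow> 'a"
    and e :: "'w \<Rightarrow> 'o \<Rightarrow> 'a"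
  assumes "coxeter_system W S"
    and "category C"
    and "braid_action W S C T c"
    and "\<forall>s\<in>S. nat_trans C C (T s \<circ>\<^sub>F T s) id_functor (e s)"
    and "\<forall>s\<in>S. \<forall>X\<in>Ob C. AMap (T s) (e s X) = e s (OMap (T s) X)"
    and "\<forall>w\<in>carrier W. \<forall>s\<in>S. \<forall>s'\<in>S.
      s \<otimes>\<^bsub>W\<^esub> w = w \<otimes>\<^bsub>W\<^esub> s' \<and> cox_length W S (s \<otimes>\<^bsub>W\<^esub> w) = cox_length W S w + 1 \<longrightarrow>
      (\<forall>X\<in>Ob C.
         AMap (T w) (e s' X) \<cdot>\<^bsub>C\<^esub>
           (inv_arrow C (c w s' (OMap (T s') X)) \<cdot>\<^bsub>C\<^esub> c s w (OMap (T s') X)) =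
         e s (OMap (T w) X) \<cdot>\<^bsub>C\<^esub>
           AMap (T s) (inv_arrow C (c s w X) \<cdot>\<^bsub>C\<^esub> c w s' X))"
  shows "\<exists>q. quasi_action W C T q \<and> extends_braid_action W S C c e q \<and>
    (\<forall>q'. quasi_action W C T q' \<and> extends_braid_action W S C c e q' \<longrightarrow>
      (\<forall>w\<in>carrier W. \<forall>w'\<in>carrier W. \<forall>X\<in>Ob C. q' w w' X = q w w' X))"
proof -
  have "group W"
    using assms(1) by (simp add: coxeter_system_def has_presentation_def)
  then interpret braid_contraction W S C T c e
    using assms
    by (simp add: braid_contraction_def coxeter_group_def coxeter_group_axioms_def
        braid_contraction_axioms_def)
  show ?thesis
    using quasi_action_quasi_mult extends_quasi_mult quasi_mult_unique by blast
qed

end
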